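(* Let $p\ge1$ be an integer and let $e_1,\dots,e_p,d_1,\dots,d_p$ be real numbers with $$0<e_1\le e_2\le\dots\le e_p,\qquad -p<d_1\le d_2\le\dots\le d_p,\qquad d_1\cdots d_p=0,$$ and, with $E=e_1+\dots+e_p$ and $D=d_1+\dots+d_p$, $$1<\frac{E-D}{p}<p-1$$ (hence $p\ge3$). Consider the indeterminate Stieltjes moment problem with birth and death rates $$\lambda_n=(pn+e_1)\cdots(pn+e_p),\qquad \mu_n=(pn+d_1)\cdots(pn+d_p),\qquad n\ge0.$$ Then the type $\tau$ of this moment problem is equal to $\tau_p/p$, where $\tau_p$ is the type of the entire function $$G_p(z)=\sum_{n=1}^\infty\gamma_n(p)z^n,$$ whose coefficients are $$\gamma_n(p)=\sum_{1\le k_1\le k_2<k_3\le k_4<\dots<k_{2n-1}\le k_{2n}}(k_1k_2\cdots k_{2n-1}k_{2n})^{-p/2}.$$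
   Context: The summation in $\gamma_n(p)$ is over positive integers with alternating inequalities: $k_{2j-1}\le k_{2j}$ and $k_{2j}<k_{2j+1}$. The Stieltjes moment problem with birth rates $\lambda_n$ and death rates $\mu_n$ ($\lambda_n,\mu_{n+1}>0$ for $n\ge 0$, $\mu_0=0$) is the moment problem with Jacobi parameters $a_n=\lambda_n+\mu_n$, $b_n=\sqrt{\lambda_n\mu_{n+1}}$, $n\ge0$. The condition $1<(E-D)/p<p-1$ is known to be equivalent to its indeterminacy. For Jacobi parameters $(a_n)$ (real), $(b_n)$ (positive), the orthonormal polynomials $P_n$ and the polynomials of the second kind $Q_n$ both satisfy $z r_n(z)=b_nr_{n+1}(z)+a_nr_n(z)+b_{n-1}r_{n-1}(z)$ for $n\ge0$, with $b_{-1}:=1$, $P_{-1}=0$, $P_0=1$, $Q_{-1}=-1$, $Q_0=0$. In the indeterminate case $\sum_{n}(P_n^2(0)+Q_n^2(0))<\infty$ and the following are entire functions: $$A(z)=z\sum_{k\ge0}Q_k(0)Q_k(z),\quad B(z)=-1+z\sum_{k\ge0}Q_k(0)P_k(z),$$ $$C(z)=1+z\sum_{k\ge0}P_k(0)Q_k(z),\quad D(z)=z\sum_{k\ge0}P_k(0)P_k(z).$$ (The function $D(z)$ is unrelated to the number $D$.) These four functions are known to have a common order $\rho\in[0,1]$ and, if $\rho>0$, a common type; these are called the order and type of the moment problem. For the moment problems considered here the order is $1/p$ (a theorem of Romanov), and $G_p$ also has order $1/p$. For a non-constant entire function $f(z)=\sum c_nz^n$ with $\mathcal M_f(r)=\max_{|z|=r}|f(z)|$,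 the order is $\rho_f=\limsup_{r\to\infty}\frac{\log\log\mathcal M_f(r)}{\log r}$, and if $0<\rho_f<\infty$ the type is $\tau_f=\limsup_{r\to\infty}\frac{\log\mathcal M_f(r)}{r^{\rho_f}}=\frac1{e\rho_f}\limsup_{n\to\infty}\left(n|c_n|^{\rho_f/n}\right)$. *)

theory Defs
  imports "HOL-Complex_Analysis.Complex_Analysis"
begin

section \<open>Order and type of entire functions\<close>

text \<open>For continuous \<open>f\<close> and \<open>r \<ge> 0\<close> the supremum is attained, so this is the maximum modulus.\<close>

definition max_modulus :: "(complex \<Rightarrow> complex) \<Rightarrow> real \<Rightarrow> real" where
  "max_modulus f r = (SUP z\<in>sphere 0 r. norm (f z))"

definition growth_order :: "(complex \<Rightarrow> complex) \<Rightarrow> ereal" where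
  "growth_order f = Limsup at_top (\<lambda>r. ereal (ln (ln (max_modulus f r)) / ln r))"

definition growth_type :: "(complex \<Rightarrow> complex) \<Rightarrow> ereal" where
  "growth_type f =
     Limsup at_top (\<lambda>r. ereal (ln (max_modulus f r) / r powr real_of_ereal (growth_order f)))"

text \<open>
  The value \<open>growth_type f\<close> is meaningful only for a non-constant entire function whose order
  is positive and finite. The following relation says that the type exists in this sense and
  equals \<open>\<tau>\<close>, which may be \<open>0\<close> or \<open>\<infinity>\<close>.
\<close>

definition has_growth_type :: "(complex \<Rightarrow> complex) \<Rightarrow> ereal \<Rightarrow> bool" where
  "has_growth_type f \<tau> \<longleftrightarrow>
     f holomorphic_on UNIV \<and> \<not> f constant_on UNIV \<and>
     0 < growth_order f \<and> growth_order f < \<infinity> \<and> growth_type f = \<tau>"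


section \<open>Moment problems given by Jacobi parameters\<close>

text \<open>
  The solution \<open>r\<close> of \<open>z r\<^sub>n = b\<^sub>n r\<^sub>n\<^sub>+\<^sub>1 + a\<^sub>n r\<^sub>n + b\<^sub>n\<^sub>-\<^sub>1 r\<^sub>n\<^sub>-\<^sub>1\<close> for \<open>n \<ge> 0\<close>, where \<open>b\<^sub>-\<^sub>1 = 1\<close>,
  with initial values \<open>r\<^sub>-\<^sub>1 = u\<close> and \<open>r\<^sub>0 = v\<close>. Indices are shifted by one:
  \<open>jacobi_rec a b z u v n\<close> is \<open>r\<^sub>n\<^sub>-\<^sub>1\<close>.
\<close>

fun jacobi_rec ::
  "(nat \<Rightarrow> real) \<Rightarrow> (nat \<Rightarrow> real) \<Rightarrow> complex \<Rightarrow> complex \<Rightarrow> complex \<Rightarrow> nat \<Rightarrow> complex" where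
  "jacobi_rec a b z u v 0 = u"
| "jacobi_rec a b z u v (Suc 0) = v"
| "jacobi_rec a b z u v (Suc (Suc n)) =
     ((z - of_real (a n)) * jacobi_rec a b z u v (Suc n)
       - of_real (if n = 0 then 1 else b (n - 1)) * jacobi_rec a b z u v n) / of_real (b n)"

definition orth_P :: "(nat \<Rightarrow> real) \<Rightarrow> (nat \<Rightarrow> real) \<Rightarrow> nat \<Rightarrow> complex \<Rightarrow> complex" where
  "orth_P a b n z = jacobi_rec a b z 0 1 (Suc n)"

definition orth_Q :: "(nat \<Rightarrow> real) \<Rightarrow> (nat \<Rightarrow> real) \<Rightarrow> nat \<Rightarrow> complex \<Rightarrow> complex" where
  "orth_Q a b n z = jacobi_rec a b z (- 1) 0 (Suc n)"

definition nevanlinna_A :: "(nat \<Rightarrow> real) \<Rightarrow> (nat \<Rightarrow> real) \<Rightarrow> complex \<Rightarrow> complex" where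
  "nevanlinna_A a b z = z * (\<Sum>k. orth_Q a b k 0 * orth_Q a b k z)"

definition nevanlinna_B :: "(nat \<Rightarrow> real) \<Rightarrow> (nat \<Rightarrow> real) \<Rightarrow> complex \<Rightarrow> complex" where
  "nevanlinna_B a b z = - 1 + z * (\<Sum>k. orth_Q a b k 0 * orth_P a b k z)"

definition nevanlinna_C :: "(nat \<Rightarrow> real) \<Rightarrow> (nat \<Rightarrow> real) \<Rightarrow> complex \<Rightarrow> complex" where
  "nevanlinna_C a b z = 1 + z * (\<Sum>k. orth_P a b k 0 * orth_Q a b k z)"

definition nevanlinna_D :: "(nat \<Rightarrow> real) \<Rightarrow> (nat \<Rightarrow> real) \<Rightarrow> complex \<Rightarrow> complex" where
  "nevanlinna_D a b z = z * (\<Sum>k. orth_P a b k 0 * orth_P a b k z)"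

text \<open>
  The type of the (indeterminate) moment problem is the type shared by the four functions above,
  which also share their order.
\<close>

definition moment_problem_has_type :: "(nat \<Rightarrow> real) \<Rightarrow> (nat \<Rightarrow> real) \<Rightarrow> ereal \<Rightarrow> bool" where
  "moment_problem_has_type a b \<tau> \<longleftrightarrow>
     (\<exists>\<rho>. \<forall>f \<in> {nevanlinna_A a b, nevanlinna_B a b, nevanlinna_C a b, nevanlinna_D a b}.
        growth_order f = \<rho> \<and> has_growth_type f \<tau>)"

text \<open>Jacobi parameters of the Stieltjes moment problem with birth rates \<open>l\<close> and death rates \<open>m\<close>.\<close>

definition birth_death_a :: "(nat \<Rightarrow> real) \<Rightarrow> (nat \<Rightarrow> real) \<Rightarrow> nat \<Rightarrow> real" where
  "birth_death_a l m n = l n + m n"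

definition birth_death_b :: "(nat \<Rightarrow> real) \<Rightarrow> (nat \<Rightarrow> real) \<Rightarrow> nat \<Rightarrow> real" where
  "birth_death_b l m n = sqrt (l n * m (n + 1))"

text \<open>The rates \<open>(pn + c\<^sub>1) \<cdots> (pn + c\<^sub>p)\<close>; the values of \<open>c\<close> outside \<open>{1..p}\<close> are irrelevant.\<close>

definition poly_rate :: "nat \<Rightarrow> (nat \<Rightarrow> real) \<Rightarrow> nat \<Rightarrow> real" where
  "poly_rate p c n = (\<Prod>i=1..p. real p * real n + c i)"


section \<open>The comparison function\<close>

text \<open>The tuples \<open>1 \<le> k\<^sub>1 \<le> k\<^sub>2 < k\<^sub>3 \<le> k\<^sub>4 < \<cdots> < k\<^sub>2\<^sub>n\<^sub>-\<^sub>1 \<le> k\<^sub>2\<^sub>n\<close>, as extensional functions on \<open>{1..2n}\<close>.\<close>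

definition alternating_chains :: "nat \<Rightarrow> (nat \<Rightarrow> nat) set" where
  "alternating_chains n =
     {k \<in> {1..2 * n} \<rightarrow>\<^sub>E {1..}.
        (\<forall>j\<in>{1..n}. k (2 * j - 1) \<le> k (2 * j)) \<and>
        (\<forall>j\<in>{1..<n}. k (2 * j) < k (2 * j + 1))}"

definition gamma_coeff :: "nat \<Rightarrow> nat \<Rightarrow> real" where
  "gamma_coeff p n =
     (\<Sum>\<^sub>\<infinity>k\<in>alternating_chains n. (\<Prod>i=1..2 * n. real (k i)) powr (- (real p / 2)))"

definition G_fun :: "nat \<Rightarrow> complex \<Rightarrow> complex" where
  "G_fun p z = (\<Sum>n. of_real (gamma_coeff p (Suc n)) * z ^ Suc n)"

end

theory Submission
  imports Defs
begin

text \<open>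
  Let \<open>\<pi>\<^sub>n = \<lambda>\<^sub>0 \<cdots> \<lambda>\<^sub>n\<^sub>-\<^sub>1 / (\<mu>\<^sub>1 \<cdots> \<mu>\<^sub>n)\<close>. Writing \<open>P\<^sub>n(z) = (-1)\<^sup>n sqrt \<pi>\<^sub>n F\<^sub>n(-z)\<close> turns the three-term
  recurrence into a discrete string equation, whose solution \<open>F\<^sub>n\<close> is a polynomial with
  nonnegative coefficients: the coefficient of \<open>w\<^sup>i\<close> is the sum of
  \<open>\<Prod>\<^sub>r \<pi>(k\<^sub>r) / (\<lambda>(j\<^sub>r) \<pi>(j\<^sub>r))\<close> over all chains \<open>k\<^sub>1 \<le> j\<^sub>1 < k\<^sub>2 \<le> j\<^sub>2 < \<cdots> \<le> j\<^sub>i < n\<close>. The second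
  solution \<open>Q\<^sub>n\<close> has the same form with one more summation at the beginning
  (\<open>orth_P_eq\<close>, \<open>orth_Q_eq\<close>). Consequently each of the functions \<open>A\<close>, \<open>B\<close>, \<open>C\<close>, \<open>D\<close> has Taylor
  coefficients which, up to sign, bounded factors and a bounded shift of the index, are the full
  chain sums \<open>\<phi>\<^sub>i\<close> with weights \<open>\<pi>\<^sub>k\<close> and \<open>1 / (\<lambda>\<^sub>j \<pi>\<^sub>j)\<close>. The numbers \<open>\<gamma>\<^sub>i(p)\<close> are chain sums
  too, with both weights equal to \<open>k powr (-p/2)\<close>.

  The main point is that the two kinds of chain sums are comparable
  (\<open>chain_coeff_compare\<close>, \<open>chain_total_compare\<close>). With \<open>s = (E - D)/p\<close> one has
  \<open>\<pi>\<^sub>k \<sim> a k powr (s - p)\<close> and \<open>1 / (\<lambda>\<^sub>k \<pi>\<^sub>k) \<sim> b k powr (-s)\<close>, where \<open>a b = p\<^sup>-\<^sup>p\<close> because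
  \<open>\<lambda>\<^sub>k \<sim> (p k)\<^sup>p\<close>. Hence the two products belonging to one chain of length \<open>i\<close> differ by a factor
  which is roughly \<open>p powr (-p i) \<cdot> \<Prod>\<^sub>r (k\<^sub>r / j\<^sub>r) powr \<delta>\<close> with \<open>\<delta> = s - p/2\<close>. The
  intervals \<open>[k\<^sub>r, j\<^sub>r]\<close> are disjoint, so this product and its inverse are bounded by a fixed power of the largest
  index, whatever the length of the chain. The summation over the last pair absorbs this power, since
  \<open>s\<close>, \<open>p - s\<close> and \<open>p/2\<close> all exceed \<open>1\<close>. Thus \<open>\<phi>\<^sub>i\<^sub>+\<^sub>1 \<le> C \<theta>\<^sup>i \<gamma>\<^sub>i\<close> for every \<open>\<theta> > p\<^sup>-\<^sup>p\<close>, and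
  symmetrically \<open>\<gamma>\<^sub>i\<^sub>+\<^sub>1 \<le> C \<theta>\<^sup>i \<phi>\<^sub>i\<close> for every \<open>\<theta> > p\<^sup>p\<close>.

  By the Cauchy inequalities these estimates become \<open>log M\<^sub>f(r) \<le> log M\<^sub>G(\<theta> r) + O(log r)\<close> and the
  converse relation (\<open>log_dominated_coeffs\<close>), so that \<open>f\<close> has the order of \<open>G\<^sub>p\<close>, and its type is
  that of \<open>G\<^sub>p(p\<^sup>-\<^sup>p z)\<close> (\<open>growth_transfer\<close>). The order of \<open>G\<^sub>p\<close> is \<open>1/p\<close>: from below because
  \<open>\<gamma>\<^sub>i(p) \<ge> (i!)\<^sup>-\<^sup>p\<close>, from above because a chain uses every index at most twice, which gives
  \<open>\<Sum>\<^sub>i \<gamma>\<^sub>i(p) w\<^sup>i \<le> \<Prod>\<^sub>k (1 + x\<^sub>k + x\<^sub>k\<^sup>2)\<close> with \<open>x\<^sub>k = sqrt w * k powr (-p/2)\<close>. Therefore the type is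
  multiplied by \<open>(p\<^sup>-\<^sup>p) powr (1/p) = 1/p\<close>.
\<close>

section \<open>Sums over alternating chains\<close>

text \<open>
  For \<open>h = 1\<close> this is the sum of \<open>\<alpha>(k\<^sub>1) \<beta>(j\<^sub>1) \<cdots> \<alpha>(k\<^sub>n) \<beta>(j\<^sub>n)\<close> over all chains
  \<open>0 \<le> k\<^sub>1 \<le> j\<^sub>1 < k\<^sub>2 \<le> j\<^sub>2 < \<cdots> \<le> j\<^sub>n < N\<close>. The recursion removes the last pair, so a general \<open>h\<close> puts
  the extra factor \<open>h(k\<^sub>1)\<close> on the smallest index (and \<open>h(N)\<close> on the empty chain). Indices start
  at \<open>0\<close>: index \<open>k\<close> here is \<open>k + 1\<close> in \<open>alternating_chains\<close>.
\<close>

primrec chain_coeff ::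
  "(nat \<Rightarrow> real) \<Rightarrow> (nat \<Rightarrow> real) \<Rightarrow> (nat \<Rightarrow> real) \<Rightarrow> nat \<Rightarrow> nat \<Rightarrow> real" where
  "chain_coeff \<alpha> \<beta> h 0 = h"
| "chain_coeff \<alpha> \<beta> h (Suc n) =
     (\<lambda>N. \<Sum>j<N. \<beta> j * (\<Sum>k\<le>j. \<alpha> k * chain_coeff \<alpha> \<beta> h n k))"

definition chain_total :: "(nat \<Rightarrow> real) \<Rightarrow> (nat \<Rightarrow> real) \<Rightarrow> nat \<Rightarrow> real" where
  "chain_total \<alpha> \<beta> n = (SUP N. chain_coeff \<alpha> \<beta> (\<lambda>_. 1) n N)"

definition chain_poly ::
  "(nat \<Rightarrow> real) \<Rightarrow> (nat \<Rightarrow> real) \<Rightarrow> (nat \<Rightarrow> real) \<Rightarrow> nat \<Rightarrow> 'a \<Rightarrow> 'a::real_normed_field" where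
  "chain_poly \<alpha> \<beta> h N w = (\<Sum>n\<le>N. of_real (chain_coeff \<alpha> \<beta> h n N) * w ^ n)"

lemma chain_coeff_eq_0: "N < n \<Longrightarrow> chain_coeff \<alpha> \<beta> h n N = 0"
proof (induction n arbitrary: N)
  case (Suc n)
  have "chain_coeff \<alpha> \<beta> h n k = 0" if "j < N" "k \<le> j" for j k
    using Suc.IH Suc.prems that by simp
  then show ?case by simp
qed simp

lemma chain_poly_sums:
  fixes w :: "'a::real_normed_field"
  shows "(\<lambda>n. of_real (chain_coeff \<alpha> \<beta> h n N) * w ^ n) sums chain_poly \<alpha> \<beta> h N w"
  unfolding chain_poly_def
  by (rule sums_finite) (auto simp: chain_coeff_eq_0)

text \<open>
  This is the discrete string equation (masses \<open>\<alpha>\<close>, gaps \<open>\<beta>\<close>) in summed form. It links the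
  combinatorial chain sums to the recurrence of the orthogonal polynomials.
\<close>

lemma chain_poly_rec:
  fixes w :: "'a::real_normed_field"
  shows "chain_poly \<alpha> \<beta> h N w =
     of_real (h N) + w * (\<Sum>j<N. of_real (\<beta> j) * (\<Sum>k\<le>j. of_real (\<alpha> k) * chain_poly \<alpha> \<beta> h k w))"
proof -
  have "(\<lambda>n. w * (\<Sum>j<N. of_real (\<beta> j) *
            (\<Sum>k\<le>j. of_real (\<alpha> k) * (of_real (chain_coeff \<alpha> \<beta> h n k) * w ^ n))))
          sums (w * (\<Sum>j<N. of_real (\<beta> j) * (\<Sum>k\<le>j. of_real (\<alpha> k) * chain_poly \<alpha> \<beta> h k w)))"
    by (intro sums_mult sums_sum chain_poly_sums)
  also have "(\<lambda>n. w * (\<Sum>j<N. of_real (\<beta> j) *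
            (\<Sum>k\<le>j. of_real (\<alpha> k) * (of_real (chain_coeff \<alpha> \<beta> h n k) * w ^ n))))
        = (\<lambda>n. of_real (chain_coeff \<alpha> \<beta> h (Suc n) N) * w ^ Suc n)"
    by (rule ext) (simp add: sum_distrib_left sum_distrib_right mult_ac)
  finally show ?thesis
    using chain_poly_sums[of \<alpha> \<beta> h N w] sums_unique2
    by (subst (asm) sums_Suc_iff) (fastforce simp: algebra_simps)
qed

lemma chain_coeff_nonneg:
  assumes "\<And>k. 0 \<le> \<alpha> k" "\<And>k. 0 \<le> \<beta> k" "\<And>k. 0 \<le> h k"
  shows "0 \<le> chain_coeff \<alpha> \<beta> h n N"
  using assms by (induction n arbitrary: N) (auto intro!: sum_nonneg mult_nonneg_nonneg)

lemma chain_coeff_mono_base: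
  assumes "\<And>k. 0 \<le> \<alpha> k" "\<And>k. 0 \<le> \<beta> k" "\<And>k. h k \<le> h' k"
  shows "chain_coeff \<alpha> \<beta> h n N \<le> chain_coeff \<alpha> \<beta> h' n N"
  using assms by (induction n arbitrary: N) (auto intro!: sum_mono mult_left_mono)

lemma chain_coeff_scale:
  "chain_coeff \<alpha> \<beta> (\<lambda>k. c * h k) n N = c * chain_coeff \<alpha> \<beta> h n N"
  by (induction n arbitrary: N) (simp_all add: sum_distrib_left mult_ac)

text \<open>
  A chain can also be extended at its beginning: the first pair is then part of the base function.
\<close>

lemma chain_coeff_Suc_base:
  "chain_coeff \<alpha> \<beta> h (Suc n) N = chain_coeff \<alpha> \<beta> (chain_coeff \<alpha> \<beta> h 1) n N"
  by (induction n arbitrary: N) simp_all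

locale chain_weights =
  fixes \<alpha> \<beta> :: "nat \<Rightarrow> real"
  assumes pos: "0 < \<alpha> k" "0 < \<beta> k"
    and summable: "summable \<alpha>" "summable \<beta>"
begin

lemma nonneg: "0 \<le> \<alpha> k" "0 \<le> \<beta> k"
  using pos less_imp_le by blast+

lemma partial_sum_le: "(\<Sum>k\<le>j. \<alpha> k) \<le> suminf \<alpha>" "(\<Sum>j<N. \<beta> j) \<le> suminf \<beta>"
  by (intro sum_le_suminf summable finite; simp add: nonneg)+

lemma suminf_weights_pos: "0 < suminf \<alpha>" "0 < suminf \<beta>"
  by (intro suminf_pos summable pos)+

lemma chain_coeff_const_nonneg: "0 \<le> chain_coeff \<alpha> \<beta> (\<lambda>_. 1) n N"
  by (intro chain_coeff_nonneg nonneg) simp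

text \<open>
  The base function \<open>N \<mapsto> \<Sum>j<N. \<beta> j\<close> belongs to the polynomials of the second kind: its chains start
  with a \<open>\<beta>\<close>. Together with the next lemma this shows that the polynomials of the first and second
  kind have comparable coefficients, up to a shift by one. Here the sum over the first \<open>\<alpha>\<close>-index
  of a chain is bounded by the sum of all \<open>\<alpha>\<close>.
\<close>

lemma chain_coeff_Suc_le_gap:
  "chain_coeff \<alpha> \<beta> (\<lambda>_. 1) (Suc n) N \<le> suminf \<alpha> * chain_coeff \<alpha> \<beta> (\<lambda>N. \<Sum>j<N. \<beta> j) n N"
proof -
  have "chain_coeff \<alpha> \<beta> (\<lambda>_. 1) (Suc n) N
      \<le> chain_coeff \<alpha> \<beta> (\<lambda>N. suminf \<alpha> * (\<Sum>j<N. \<beta> j)) n N"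
    unfolding chain_coeff_Suc_base
  proof (rule chain_coeff_mono_base[OF nonneg])
    fix N
    have "chain_coeff \<alpha> \<beta> (\<lambda>_. 1) 1 N = (\<Sum>j<N. \<beta> j * (\<Sum>k\<le>j. \<alpha> k))" by simp
    also have "\<dots> \<le> (\<Sum>j<N. \<beta> j * suminf \<alpha>)"
      by (intro sum_mono mult_left_mono partial_sum_le nonneg)
    finally show "chain_coeff \<alpha> \<beta> (\<lambda>_. 1) 1 N \<le> suminf \<alpha> * (\<Sum>j<N. \<beta> j)"
      by (simp add: sum_distrib_left mult_ac)
  qed
  then show ?thesis by (simp add: chain_coeff_scale)
qed

lemma chain_coeff_gap_le:
  "chain_coeff \<alpha> \<beta> (\<lambda>N. \<Sum>j<N. \<beta> j) n N \<le> suminf \<beta> * chain_coeff \<alpha> \<beta> (\<lambda>_. 1) n N"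
proof -
  have "chain_coeff \<alpha> \<beta> (\<lambda>N. \<Sum>j<N. \<beta> j) n N \<le> chain_coeff \<alpha> \<beta> (\<lambda>_. suminf \<beta> * 1) n N"
    by (intro chain_coeff_mono_base nonneg) (simp add: partial_sum_le)
  then show ?thesis by (simp only: chain_coeff_scale)
qed

lemma bdd_above_chain_coeff: "bdd_above (range (chain_coeff \<alpha> \<beta> (\<lambda>_. 1) n))"
proof -
  have "chain_coeff \<alpha> \<beta> (\<lambda>_. 1) n N \<le> (suminf \<alpha> * suminf \<beta>) ^ n" for N
  proof (induction n)
    case (Suc n)
    have "chain_coeff \<alpha> \<beta> (\<lambda>_. 1) (Suc n) N \<le> suminf \<alpha> * (suminf \<beta> * chain_coeff \<alpha> \<beta> (\<lambda>_. 1) n N)"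
      by (rule order_trans[OF chain_coeff_Suc_le_gap mult_left_mono[OF chain_coeff_gap_le]])
         (use suminf_weights_pos in simp)
    also have "\<dots> \<le> suminf \<alpha> * (suminf \<beta> * (suminf \<alpha> * suminf \<beta>) ^ n)"
      using suminf_weights_pos Suc by (intro mult_left_mono) auto
    finally show ?case by (simp add: mult_ac)
  qed simp
  then show ?thesis by (auto intro!: bdd_aboveI)
qed

lemma chain_coeff_le_total: "chain_coeff \<alpha> \<beta> (\<lambda>_. 1) n N \<le> chain_total \<alpha> \<beta> n"
  unfolding chain_total_def by (intro cSUP_upper bdd_above_chain_coeff) simp

lemma chain_total_least:
  "(\<And>N. chain_coeff \<alpha> \<beta> (\<lambda>_. 1) n N \<le> b) \<Longrightarrow> chain_total \<alpha> \<beta> n \<le> b"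
  unfolding chain_total_def by (intro cSUP_least) auto

lemma chain_total_nonneg: "0 \<le> chain_total \<alpha> \<beta> n"
  using chain_coeff_const_nonneg chain_coeff_le_total order_trans by blast

lemma summable_mass_chain: "summable (\<lambda>k. \<alpha> k * chain_coeff \<alpha> \<beta> (\<lambda>_. 1) n k)"
  by (rule summable_comparison_test'[OF summable_mult2[OF summable(1), of "chain_total \<alpha> \<beta> n"], of 0])
     (simp add: nonneg chain_coeff_const_nonneg chain_coeff_le_total mult_left_mono)

lemma chain_total_Suc_le:
  "chain_total \<alpha> \<beta> (Suc n) \<le> suminf \<beta> * (\<Sum>k. \<alpha> k * chain_coeff \<alpha> \<beta> (\<lambda>_. 1) n k)"
proof (rule chain_total_least)
  fix N
  have "chain_coeff \<alpha> \<beta> (\<lambda>_. 1) (Suc n) N \<le> (\<Sum>j<N. \<beta> j * (\<Sum>k. \<alpha> k * chain_coeff \<alpha> \<beta> (\<lambda>_. 1) n k))"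
    unfolding chain_coeff.simps
    by (intro sum_mono mult_left_mono nonneg sum_le_suminf summable_mass_chain)
       (auto simp: nonneg chain_coeff_const_nonneg)
  also have "\<dots> \<le> suminf \<beta> * (\<Sum>k. \<alpha> k * chain_coeff \<alpha> \<beta> (\<lambda>_. 1) n k)"
    unfolding sum_distrib_right[symmetric]
    by (intro mult_right_mono partial_sum_le suminf_nonneg summable_mass_chain)
       (simp add: nonneg chain_coeff_const_nonneg)
  finally show "chain_coeff \<alpha> \<beta> (\<lambda>_. 1) (Suc n) N \<le> \<dots>" .
qed

end

section \<open>Weights with the same sum of exponents\<close>

text \<open>
  The weight \<open>\<rho>\<close> absorbs the factors \<open>(k / j) powr \<delta>\<close> that a chain collects on its disjoint intervals
  \<open>[k, j]\<close>; the hypotheses say that \<open>\<rho>\<close> pays for one interval at a time, so it appears only once in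
  the conclusion. The sharp constant \<open>\<theta>\<close> is available only for indices \<open>\<ge> k0\<close>. Since a chain with
  \<open>n\<close> pairs before \<open>k\<close> forces \<open>k \<ge> n\<close>, the crude constant \<open>C\<close> is needed for at most \<open>k0\<close> of the
  steps, hence the bounded factor \<open>(C / \<theta>) ^ min n k0\<close>.
\<close>

lemma chain_coeff_compare:
  assumes nn: "\<And>k. 0 \<le> \<alpha> k" "\<And>k. 0 \<le> \<beta> k" "\<And>k. 0 \<le> \<alpha>' k" "\<And>k. 0 \<le> \<beta>' k"
    and \<rho>: "mono \<rho>" "\<And>k. 1 \<le> \<rho> k"
    and q: "0 \<le> C" "0 < \<theta>" "\<theta> \<le> C"
      "\<And>k j. k \<le> j \<Longrightarrow> \<alpha> k * \<beta> j * \<rho> k \<le> C * (\<alpha>' k * \<beta>' j * \<rho> j)"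
      "\<And>k j. k0 \<le> k \<Longrightarrow> k \<le> j \<Longrightarrow> \<alpha> k * \<beta> j * \<rho> k \<le> \<theta> * (\<alpha>' k * \<beta>' j * \<rho> j)"
  shows "chain_coeff \<alpha> \<beta> (\<lambda>_. 1) n N \<le> (C / \<theta>) ^ min n k0 * \<theta> ^ n * (\<rho> N * chain_coeff \<alpha>' \<beta>' (\<lambda>_. 1) n N)"
proof (induction n arbitrary: N)
  case 0
  then show ?case using \<rho> by simp
next
  case (Suc n)
  define K where "K = (C / \<theta>) ^ min n k0 * \<theta> ^ n"
  define c where "c = (if n < k0 then C else \<theta>)"
  have K0: "0 \<le> K" "0 \<le> c" using q by (auto simp: K_def c_def)
  have Kc: "K * c = (C / \<theta>) ^ min (Suc n) k0 * \<theta> ^ Suc n"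
  proof (cases "n < k0")
    case True
    then have "min n k0 = n" "min (Suc n) k0 = Suc n" by auto
    then show ?thesis using True q by (simp add: K_def c_def field_simps)
  next
    case False
    then have "min n k0 = k0" "min (Suc n) k0 = k0" by auto
    then show ?thesis using False q by (simp add: K_def c_def field_simps)
  qed
  let ?f = "chain_coeff \<alpha> \<beta> (\<lambda>_. 1)" and ?g = "chain_coeff \<alpha>' \<beta>' (\<lambda>_. 1)"
  have g0: "0 \<le> ?g n k" for n k by (intro chain_coeff_nonneg nn) simp
  have *: "\<beta> j * (\<alpha> k * ?f n k) \<le> K * c * \<rho> N * (\<beta>' j * (\<alpha>' k * ?g n k))"
    if jk: "j < N" "k \<le> j" for j k
  proof (cases "k < n")
    case True
    then show ?thesis by (simp add: chain_coeff_eq_0)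
  next
    case False
    have "\<beta> j * (\<alpha> k * ?f n k) \<le> \<beta> j * (\<alpha> k * (K * (\<rho> k * ?g n k)))"
      using Suc.IH[of k] by (intro mult_left_mono nn) (simp add: K_def)
    also have "\<dots> = (K * ?g n k) * (\<alpha> k * \<beta> j * \<rho> k)" by (simp add: mult_ac)
    also have "\<dots> \<le> (K * ?g n k) * (c * (\<alpha>' k * \<beta>' j * \<rho> j))"
      using False jk q by (intro mult_left_mono) (auto simp: c_def K0 g0)
    also have "\<dots> \<le> (K * ?g n k) * (c * (\<alpha>' k * \<beta>' j * \<rho> N))"
      using jk monoD[OF \<rho>(1), of j N] by (intro mult_left_mono) (auto simp: K0 g0 nn)
    finally show ?thesis by (simp add: mult_ac)
  qed
  have "?f (Suc n) N = (\<Sum>j<N. \<Sum>k\<le>j. \<beta> j * (\<alpha> k * ?f n k))"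
    by (simp add: sum_distrib_left)
  also have "\<dots> \<le> (\<Sum>j<N. \<Sum>k\<le>j. K * c * \<rho> N * (\<beta>' j * (\<alpha>' k * ?g n k)))"
    by (intro sum_mono *) auto
  also have "\<dots> = K * c * (\<rho> N * ?g (Suc n) N)"
    by (simp add: sum_distrib_left mult_ac)
  finally show ?case using Kc by simp
qed

lemma summable_powr_limit:
  fixes x :: "nat \<Rightarrow> real"
  assumes "(\<lambda>k. x k * real (Suc k) powr u) \<longlonglongrightarrow> a" "1 < u"
  shows "summable x"
proof -
  obtain K where K: "\<And>k. norm (x k * real (Suc k) powr u) \<le> K"
    using convergent_imp_Bseq[OF convergentI[OF assms(1)]] unfolding Bseq_def by blast
  have "summable (\<lambda>k. real (Suc k) powr (- u))"
    using assms(2) by (subst summable_Suc_iff[of "\<lambda>k. real k powr (- u)"])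
      (simp add: summable_real_powr_iff)
  then have "summable (\<lambda>k. K * real (Suc k) powr (- u))" by (rule summable_mult)
  then show ?thesis
  proof (rule summable_comparison_test')
    fix k :: nat
    have "norm (x k) = norm (x k * real (Suc k) powr u) * real (Suc k) powr (- u)"
      by (simp add: abs_mult powr_minus field_simps)
    also have "\<dots> \<le> K * real (Suc k) powr (- u)"
      by (intro mult_right_mono K) simp
    finally show "norm (x k) \<le> K * real (Suc k) powr (- u)" .
  qed
qed

lemma chain_weightsI:
  assumes "\<And>k. 0 < \<alpha> k" "\<And>k. 0 < \<beta> k" "1 < u" "1 < v"
    and "(\<lambda>k. \<alpha> k * real (Suc k) powr u) \<longlonglongrightarrow> a"
    and "(\<lambda>k. \<beta> k * real (Suc k) powr v) \<longlonglongrightarrow> b"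
  shows "chain_weights \<alpha> \<beta>"
proof
  show "summable \<alpha>" by (rule summable_powr_limit[OF assms(5,3)])
  show "summable \<beta>" by (rule summable_powr_limit[OF assms(6,4)])
qed (fact assms)+

text \<open>
  Only the product of the weights matters for the exponential growth rate of the chain sums: moving
  a power of the index from \<open>\<alpha>\<close> to \<open>\<beta>\<close> costs one power of the largest index of a chain. The shift
  from \<open>n\<close> to \<open>Suc n\<close> provides the last pair whose summation absorbs this power.
\<close>

lemma chain_total_compare:
  assumes W: "chain_weights \<alpha> \<beta>" "chain_weights \<alpha>' \<beta>'"
    and lim: "(\<lambda>k. \<alpha> k * real (Suc k) powr u) \<longlonglongrightarrow> a"
             "(\<lambda>k. \<beta> k * real (Suc k) powr v) \<longlonglongrightarrow> b"
             "(\<lambda>k. \<alpha>' k * real (Suc k) powr u') \<longlonglongrightarrow> a'"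
             "(\<lambda>k. \<beta>' k * real (Suc k) powr v') \<longlonglongrightarrow> b'"
    and pos: "0 < a" "0 < b" "0 < a'" "0 < b'"
    and ex: "1 < u" "1 < u'" "u + v = u' + v'"
    and \<theta>: "a * b / (a' * b') < \<theta>"
  shows "\<exists>C\<ge>0. \<forall>n. chain_total \<alpha> \<beta> (Suc n) \<le> C * \<theta> ^ n * chain_total \<alpha>' \<beta>' n"
proof -
  interpret W: chain_weights \<alpha> \<beta> by fact
  interpret W': chain_weights \<alpha>' \<beta>' by fact
  define \<delta> where "\<delta> = u' - u"
  \<comment> \<open>A factor \<open>(k / j) powr \<delta>\<close> with \<open>k \<le> j\<close> exceeds \<open>1\<close> only for \<open>\<delta> < 0\<close>; then \<open>\<rho>\<close> compensates it.\<close>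
  define \<rho> where "\<rho> k = real (Suc k) powr max 0 (- \<delta>)" for k
  define R where "R k = \<alpha> k / \<alpha>' k * real (Suc k) powr (- \<delta>)" for k
  define T where "T k = \<beta> k / \<beta>' k * real (Suc k) powr \<delta>" for k
  have \<delta>': "\<delta> = v - v'" using ex by (simp add: \<delta>_def)
  have "(\<lambda>k. (\<alpha> k * real (Suc k) powr u) / (\<alpha>' k * real (Suc k) powr u')) \<longlonglongrightarrow> a / a'"
    using pos by (intro tendsto_divide lim) auto
  also have "(\<lambda>k. (\<alpha> k * real (Suc k) powr u) / (\<alpha>' k * real (Suc k) powr u')) = R"
    by (rule ext) (simp add: R_def \<delta>_def powr_diff)
  finally have R: "R \<longlonglongrightarrow> a / a'" .
  have "(\<lambda>k. (\<beta> k * real (Suc k) powr v) / (\<beta>' k * real (Suc k) powr v')) \<longlonglongrightarrow> b / b'"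
    using pos by (intro tendsto_divide lim) auto
  also have "(\<lambda>k. (\<beta> k * real (Suc k) powr v) / (\<beta>' k * real (Suc k) powr v')) = T"
    by (rule ext) (simp add: T_def \<delta>' powr_diff)
  finally have T: "T \<longlonglongrightarrow> b / b'" .
  have RT0: "0 < R k" "0 < T k" for k
    using W.pos W'.pos by (auto simp: R_def T_def)
  have \<theta>0: "0 < \<theta>" using \<theta> pos by (auto intro: le_less_trans[rotated])
  obtain CR where CR: "\<And>k. norm (R k) \<le> CR"
    using convergent_imp_Bseq[OF convergentI[OF R]] unfolding Bseq_def by blast
  obtain CT where CT: "\<And>k. norm (T k) \<le> CT"
    using convergent_imp_Bseq[OF convergentI[OF T]] unfolding Bseq_def by blast
  have "a / a' < \<theta> / (b / b')" using \<theta> pos by (simp add: field_simps)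
  \<comment> \<open>Split \<open>\<theta>\<close> into a factor above the limit of \<open>R\<close> and one above the limit of \<open>T\<close>.\<close>
  then obtain r where r: "a / a' < r" "r < \<theta> / (b / b')" using dense by blast
  have r0: "0 < r" using r(1) pos by (auto intro: less_trans[rotated])
  have "b / b' < \<theta> / r" using r(2) r0 pos by (simp add: field_simps)
  then have "eventually (\<lambda>k. R k < r \<and> T k < \<theta> / r) sequentially"
    using order_tendstoD(2)[OF R r(1)] order_tendstoD(2)[OF T] by (simp add: eventually_conj_iff)
  then obtain k0 where k0: "\<And>k. k0 \<le> k \<Longrightarrow> R k < r" "\<And>k. k0 \<le> k \<Longrightarrow> T k < \<theta> / r"
    by (auto simp: eventually_sequentially)
  define C where "C = max \<theta> (CR * CT)"
  have powr_le: "(real (Suc k) / real (Suc j)) powr \<delta> * \<rho> k \<le> \<rho> j" if "k \<le> j" for k j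
  proof (cases "0 \<le> \<delta>")
    case True
    have "(real (Suc k) / real (Suc j)) powr \<delta> \<le> 1 powr \<delta>"
      using True that by (intro powr_mono2) auto
    then show ?thesis using True by (simp add: \<rho>_def)
  next
    case False
    then show ?thesis by (simp add: \<rho>_def powr_divide powr_minus field_simps)
  qed
  have main: "\<alpha> k * \<beta> j * \<rho> k \<le> R k * T j * (\<alpha>' k * \<beta>' j * \<rho> j)" if "k \<le> j" for k j
  proof -
    have "\<alpha> k * \<beta> j * \<rho> k
        = R k * T j * (\<alpha>' k * \<beta>' j) * ((real (Suc k) / real (Suc j)) powr \<delta> * \<rho> k)"
      using W'.pos[of k] W'.pos[of j] by (simp add: R_def T_def powr_divide powr_minus field_simps)
    also have "\<dots> \<le> R k * T j * (\<alpha>' k * \<beta>' j) * \<rho> j"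
      by (intro mult_left_mono powr_le that mult_nonneg_nonneg W'.nonneg less_imp_le[OF RT0(1)]
            less_imp_le[OF RT0(2)])
    finally show ?thesis by (simp add: mult_ac)
  qed
  have \<rho>0: "1 \<le> \<rho> k" for k unfolding \<rho>_def by (rule ge_one_powr_ge_zero) auto
  have nn: "0 \<le> \<alpha>' k * \<beta>' j * \<rho> j" for k j
    using W'.nonneg \<rho>0[of j] by (intro mult_nonneg_nonneg) auto
  have step: "\<alpha> k * \<beta> j * \<rho> k \<le> X * (\<alpha>' k * \<beta>' j * \<rho> j)" if "k \<le> j" "R k * T j \<le> X" for k j X
    using main[OF that(1)] mult_right_mono[OF that(2) nn[of k j]] by linarith
  have bnd: "chain_coeff \<alpha> \<beta> (\<lambda>_. 1) n N
      \<le> (C / \<theta>) ^ min n k0 * \<theta> ^ n * (\<rho> N * chain_coeff \<alpha>' \<beta>' (\<lambda>_. 1) n N)" for n N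
  proof (rule chain_coeff_compare)
    show "mono \<rho>" by (auto simp: \<rho>_def intro!: monoI powr_mono2)
    show "\<alpha> k * \<beta> j * \<rho> k \<le> C * (\<alpha>' k * \<beta>' j * \<rho> j)" if "k \<le> j" for k j
    proof (rule step[OF that])
      have "R k * T j \<le> CR * CT"
        using CR[of k] CT[of j] RT0[of k] RT0[of j] by (intro mult_mono) auto
      then show "R k * T j \<le> C" by (simp add: C_def)
    qed
    show "\<alpha> k * \<beta> j * \<rho> k \<le> \<theta> * (\<alpha>' k * \<beta>' j * \<rho> j)" if "k0 \<le> k" "k \<le> j" for k j
    proof (rule step[OF that(2)])
      have "R k * T j \<le> r * (\<theta> / r)"
        using k0[of k] k0[of j] that RT0[of k] RT0[of j] r0 by (intro mult_mono) auto
      then show "R k * T j \<le> \<theta>" using r0 by simp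
    qed
  qed (use W.nonneg W'.nonneg \<rho>0 \<theta>0 in \<open>auto simp: C_def\<close>)
  \<comment> \<open>For \<open>\<delta> < 0\<close> the terms \<open>\<alpha> k * \<rho> k\<close> still decay like \<open>k powr (- u')\<close>.\<close>
  have sum\<rho>: "summable (\<lambda>k. \<alpha> k * \<rho> k)"
  proof (rule summable_powr_limit)
    show "(\<lambda>k. \<alpha> k * \<rho> k * real (Suc k) powr min u u') \<longlonglongrightarrow> a"
    proof -
      have "\<rho> k * real (Suc k) powr min u u' = real (Suc k) powr u" for k
        unfolding \<rho>_def \<delta>_def by (subst powr_add[symmetric]) (auto simp: max_def min_def)
      then show ?thesis using lim(1) by (simp only: mult.assoc)
    qed
  qed (use ex in simp)
  define S where "S = (\<Sum>k. \<alpha> k * \<rho> k)"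
  define Q where "Q = (C / \<theta>) ^ k0"
  have Q1: "1 \<le> C / \<theta>" using \<theta>0 by (simp add: C_def)
  have \<alpha>\<rho>: "0 \<le> \<alpha> k * \<rho> k" for k using W.nonneg \<rho>0[of k] by (intro mult_nonneg_nonneg) auto
  have "chain_total \<alpha> \<beta> (Suc n) \<le> suminf \<beta> * Q * S * \<theta> ^ n * chain_total \<alpha>' \<beta>' n" for n
  proof -
    have "\<alpha> k * chain_coeff \<alpha> \<beta> (\<lambda>_. 1) n k \<le> \<alpha> k * \<rho> k * (Q * \<theta> ^ n * chain_total \<alpha>' \<beta>' n)" for k
    proof -
      have "(C / \<theta>) ^ min n k0 \<le> Q" unfolding Q_def using Q1 by (intro power_increasing) auto
      then have "(C / \<theta>) ^ min n k0 * \<theta> ^ n * (\<rho> k * chain_coeff \<alpha>' \<beta>' (\<lambda>_. 1) n k)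
          \<le> Q * \<theta> ^ n * (\<rho> k * chain_total \<alpha>' \<beta>' n)"
        using W'.chain_coeff_const_nonneg \<theta>0 \<rho>0[of k] Q1 W'.chain_coeff_le_total
        by (intro mult_mono mult_nonneg_nonneg) (auto simp: Q_def)
      then have "chain_coeff \<alpha> \<beta> (\<lambda>_. 1) n k \<le> Q * \<theta> ^ n * (\<rho> k * chain_total \<alpha>' \<beta>' n)"
        using bnd order_trans by blast
      from mult_left_mono[OF this W.nonneg(1)] show ?thesis by (simp add: mult_ac)
    qed
    then have "(\<Sum>k. \<alpha> k * chain_coeff \<alpha> \<beta> (\<lambda>_. 1) n k) \<le> S * (Q * \<theta> ^ n * chain_total \<alpha>' \<beta>' n)"
      unfolding S_def suminf_mult2[OF sum\<rho>]
      by (intro suminf_le W.summable_mass_chain summable_mult2 sum\<rho>)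
    from mult_left_mono[OF this, of "suminf \<beta>"]
    have "suminf \<beta> * (\<Sum>k. \<alpha> k * chain_coeff \<alpha> \<beta> (\<lambda>_. 1) n k)
        \<le> suminf \<beta> * (S * (Q * \<theta> ^ n * chain_total \<alpha>' \<beta>' n))"
      using W.suminf_weights_pos by simp
    with W.chain_total_Suc_le[of n] show ?thesis by (simp add: mult_ac)
  qed
  moreover have "0 \<le> suminf \<beta> * Q * S"
  proof -
    have "0 \<le> S" unfolding S_def by (intro suminf_nonneg sum\<rho> \<alpha>\<rho>)
    moreover have "0 \<le> Q" unfolding Q_def using Q1 by (intro zero_le_power) linarith
    ultimately show ?thesis using W.suminf_weights_pos by simp
  qed
  ultimately show ?thesis by blast
qed

section \<open>Order and type under comparison of coefficients\<close>

text \<open>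
  For every \<open>\<rho> > 0\<close> the term \<open>K + m * ln r\<close> is negligible against \<open>r powr \<rho>\<close>, so the relation
  compares both orders and types. Admitting all \<open>\<theta> > \<kappa>\<close> in place of \<open>\<kappa>\<close> itself leaves room for
  subexponential factors in the coefficients.
\<close>

definition log_dominated :: "real \<Rightarrow> (complex \<Rightarrow> complex) \<Rightarrow> (complex \<Rightarrow> complex) \<Rightarrow> bool" where
  "log_dominated \<kappa> f g \<longleftrightarrow> (\<forall>\<theta>>\<kappa>. \<exists>K m. \<forall>\<^sub>F r in at_top.
     ln (max_modulus f r) \<le> K + m * ln r + ln (max_modulus g (\<theta> * r)))"

lemma max_modulus_le:
  assumes "0 \<le> r" "\<And>z. norm z = r \<Longrightarrow> norm (f z) \<le> B"
  shows "max_modulus f r \<le> B"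
  unfolding max_modulus_def
proof (rule cSUP_least)
  have "complex_of_real r \<in> sphere 0 r" using assms(1) by simp
  then show "sphere (0::complex) r \<noteq> {}" by blast
qed (use assms(2) in auto)

lemma norm_le_max_modulus:
  assumes "continuous_on UNIV f" "norm z = r"
  shows "norm (f z) \<le> max_modulus f r"
  unfolding max_modulus_def
proof (rule cSUP_upper)
  have "continuous_on (sphere 0 r) (\<lambda>z. norm (f z))"
    by (intro continuous_on_norm continuous_on_subset[OF assms(1)]) auto
  then have "compact ((\<lambda>z. norm (f z)) ` sphere 0 r)"
    using compact_continuous_image compact_sphere by blast
  then show "bdd_above ((\<lambda>z. norm (f z)) ` sphere 0 r)"
    by (rule bounded_imp_bdd_above[OF compact_imp_bounded])
qed (use assms(2) in auto)

locale entire_series =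
  fixes a :: "nat \<Rightarrow> complex" and f :: "complex \<Rightarrow> complex"
  assumes sums: "(\<lambda>n. a n * z ^ n) sums f z"
begin

lemma holomorphic: "f holomorphic_on UNIV"
proof -
  have "f field_differentiable at z" for z
  proof -
    have "f holomorphic_on ball 0 (norm z + 1)"
      by (rule power_series_holomorphic[of _ _ a]) (use sums in simp)
    then show ?thesis by (rule holomorphic_on_imp_differentiable_at) auto
  qed
  then show ?thesis by (simp add: holomorphic_on_def field_differentiable_at_within)
qed

lemma continuous: "continuous_on S f"
  using holomorphic holomorphic_on_imp_continuous_on continuous_on_subset by blast

lemma coeff_eq_deriv: "a n = (deriv ^^ n) f 0 / fact n"
proof -
  have "f has_fps_expansion Abs_fps a"
    by (rule has_fps_expansionI) (use sums in simp)
  then show ?thesis using fps_nth_fps_expansion by fastforce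
qed

lemma Cauchy_bound:
  assumes "0 < r"
  shows "norm (a n) * r ^ n \<le> max_modulus f r"
proof -
  have "norm ((deriv ^^ n) f 0) \<le> fact n * max_modulus f r / r ^ n"
  proof (rule Cauchy_inequality)
    show "f holomorphic_on ball 0 r" using holomorphic holomorphic_on_subset by blast
    show "norm (f x) \<le> max_modulus f r" if "norm (0 - x) = r" for x
      using that by (intro norm_le_max_modulus continuous) simp
  qed (use assms continuous in auto)
  then show ?thesis using assms by (simp add: coeff_eq_deriv norm_divide field_simps)
qed

lemma eventually_max_modulus_ge_1:
  assumes "a i \<noteq> 0" "0 < i"
  shows "\<forall>\<^sub>F r in at_top. 1 \<le> max_modulus f r"
proof -
  have "filterlim (\<lambda>r. norm (a i) * r ^ i) at_top at_top"
    using assms by (intro filterlim_tendsto_pos_mult_at_top[OF tendsto_const]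
        filterlim_pow_at_top filterlim_ident) auto
  then have "\<forall>\<^sub>F r in at_top. 1 \<le> norm (a i) * r ^ i"
    by (simp add: filterlim_at_top)
  then show ?thesis using eventually_gt_at_top[of 0]
    by eventually_elim (use Cauchy_bound order_trans in blast)
qed

lemma not_constant:
  assumes "a i \<noteq> 0" "0 < i"
  shows "\<not> f constant_on UNIV"
proof
  assume "f constant_on UNIV"
  then obtain c where "f = (\<lambda>_. c)" by (auto simp: constant_on_def)
  then have "(deriv ^^ i) f 0 = 0" using assms(2) by (cases i) (simp_all del: funpow.simps add: higher_deriv_const)
  then show False using assms(1) by (simp add: coeff_eq_deriv)
qed

end

text \<open>
  By the Cauchy inequality for \<open>g\<close> on the circle of radius \<open>\<theta>' * r\<close> with \<open>\<theta>' > \<theta>\<close>, the terms of the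
  series of \<open>f\<close> on the circle of radius \<open>r\<close> are bounded by a geometric series with ratio \<open>\<theta> / \<theta>'\<close>.
  The finitely many other terms and the index shift cost only a power of \<open>r\<close>. The nonzero
  coefficients keep both maximum moduli eventually at least \<open>1\<close>, where the logarithm is monotone and
  nonnegative.
\<close>

lemma log_dominated_coeffs:
  assumes f: "entire_series a f" and g: "entire_series c g"
    and dom: "\<And>\<theta>. \<kappa> < \<theta> \<Longrightarrow> \<exists>C. \<forall>n\<ge>n0. norm (a (n + m)) \<le> C * \<theta> ^ n * norm (c n)"
    and nz: "a i \<noteq> 0" "0 < i" "c i' \<noteq> 0" "0 < i'" and \<kappa>: "0 < \<kappa>"
  shows "log_dominated \<kappa> f g"
  unfolding log_dominated_def
proof (intro allI impI)
  interpret f: entire_series a f by fact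
  interpret g: entire_series c g by fact
  fix \<theta>' :: real assume "\<kappa> < \<theta>'"
  then obtain \<theta> where \<theta>: "\<kappa> < \<theta>" "\<theta> < \<theta>'" using dense by blast
  obtain C0 where C0: "\<And>n. n0 \<le> n \<Longrightarrow> norm (a (n + m)) \<le> C0 * \<theta> ^ n * norm (c n)"
    using dom[OF \<theta>(1)] by blast
  define C where "C = max C0 0"
  define q where "q = \<theta> / \<theta>'"
  have \<theta>0: "0 < \<theta>" "0 < \<theta>'" "0 \<le> q" "q < 1" using \<theta> \<kappa> by (auto simp: q_def)
  have C: "norm (a (n + m)) \<le> C * \<theta> ^ n * norm (c n)" if "n0 \<le> n" for n
  proof -
    have "C0 * \<theta> ^ n * norm (c n) \<le> C * \<theta> ^ n * norm (c n)"
      unfolding C_def using \<theta>0 by (intro mult_right_mono) auto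
    then show ?thesis using C0[OF that] by linarith
  qed
  define N where "N = n0 + m"
  define S where "S = (\<Sum>n<N. norm (a n))"
  define B where "B = S + C / (1 - q) + 1"
  have S0: "0 \<le> S" by (simp add: S_def sum_nonneg)
  have CC: "0 \<le> C / (1 - q)" using \<theta>0 by (simp add: C_def)
  then have B0: "0 < B" using S0 by (simp add: B_def)
  have bound: "max_modulus f r \<le> B * r ^ N * max_modulus g (\<theta>' * r)"
    if r: "1 \<le> r" and M: "1 \<le> max_modulus g (\<theta>' * r)" for r
  proof (rule max_modulus_le)
    define X where "X = max_modulus g (\<theta>' * r)"
    have X1: "1 \<le> X" using M by (simp add: X_def)
    fix z :: complex assume z: "norm z = r"
    have tail: "norm (a (n + N) * z ^ (n + N)) \<le> C * r ^ N * X * q ^ n" for n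
    proof -
      have R: "0 < \<theta>' * r" using \<theta>0 r by simp
      have cn: "norm (c (n + n0)) \<le> X / (\<theta>' * r) ^ (n + n0)"
        using g.Cauchy_bound[OF R, of "n + n0"] zero_less_power[OF R, of "n + n0"]
        by (simp only: X_def pos_le_divide_eq)
      have "norm (a (n + N) * z ^ (n + N)) = norm (a ((n + n0) + m)) * r ^ (n + N)"
        by (simp add: norm_mult norm_power z N_def add.assoc)
      also have "\<dots> \<le> (C * \<theta> ^ (n + n0) * norm (c (n + n0))) * r ^ (n + N)"
        using r by (intro mult_right_mono C) auto
      also have "\<dots> \<le> (C * \<theta> ^ (n + n0) * (X / (\<theta>' * r) ^ (n + n0))) * r ^ (n + N)"
        using r \<theta>0 by (intro mult_right_mono mult_left_mono cn) (auto simp: C_def)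
      also have "\<dots> = C * X * q ^ (n + n0) * r ^ m"
        using r \<theta>0 by (simp add: q_def N_def power_mult_distrib power_divide power_add field_simps)
      also have "\<dots> \<le> C * X * q ^ n * r ^ N"
        using r \<theta>0 X1 by (intro mult_mono power_decreasing power_increasing mult_left_mono)
          (auto simp: C_def N_def)
      finally show ?thesis by (simp add: mult_ac)
    qed
    have geo: "summable (\<lambda>n. C * r ^ N * X * q ^ n)"
      using \<theta>0 by (intro summable_mult summable_geometric) auto
    have "f z = (\<Sum>n. a n * z ^ n)" using f.sums sums_unique by blast
    also have "\<dots> = (\<Sum>n. a (n + N) * z ^ (n + N)) + (\<Sum>n<N. a n * z ^ n)"
      using f.sums by (intro suminf_split_initial_segment) (auto simp: sums_iff)
    also have "norm \<dots> \<le> C * r ^ N * X / (1 - q) + S * r ^ N"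
    proof (rule norm_triangle_mono)
      have "norm (\<Sum>n. a (n + N) * z ^ (n + N)) \<le> (\<Sum>n. C * r ^ N * X * q ^ n)"
        by (intro norm_suminf_le tail geo)
      also have "\<dots> = C * r ^ N * X / (1 - q)"
        using \<theta>0 by (subst suminf_mult) (auto simp: suminf_geometric)
      finally show "norm (\<Sum>n. a (n + N) * z ^ (n + N)) \<le> C * r ^ N * X / (1 - q)" .
      have "norm (\<Sum>n<N. a n * z ^ n) \<le> (\<Sum>n<N. norm (a n) * r ^ N)"
        using r by (intro sum_norm_le)
          (auto simp: norm_mult norm_power z intro!: mult_left_mono power_increasing)
      then show "norm (\<Sum>n<N. a n * z ^ n) \<le> S * r ^ N" by (simp add: S_def sum_distrib_right)
    qed
    also have "\<dots> \<le> B * r ^ N * X"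
    proof -
      have "S * r ^ N * 1 \<le> S * r ^ N * X" using X1 S0 r by (intro mult_left_mono) auto
      moreover have "0 \<le> r ^ N * X" using r X1 by simp
      ultimately show ?thesis by (simp add: B_def algebra_simps)
    qed
    finally show "norm (f z) \<le> B * r ^ N * max_modulus g (\<theta>' * r)" by (simp add: X_def)
  qed (use r in simp)
  have "filterlim (\<lambda>r. \<theta>' * r) at_top at_top"
    by (intro filterlim_tendsto_pos_mult_at_top[OF tendsto_const] filterlim_ident \<theta>0)
  then have "\<forall>\<^sub>F r in at_top. 1 \<le> max_modulus g (\<theta>' * r)"
    using g.eventually_max_modulus_ge_1[OF nz(3,4)] eventually_compose_filterlim by blast
  then have "\<forall>\<^sub>F r in at_top. ln (max_modulus f r) \<le> ln B + N * ln r + ln (max_modulus g (\<theta>' * r))"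
    using f.eventually_max_modulus_ge_1[OF nz(1,2)] eventually_ge_at_top[of 1]
  proof eventually_elim
    case (elim r)
    have "ln (max_modulus f r) \<le> ln (B * r ^ N * max_modulus g (\<theta>' * r))"
      using elim bound by (subst ln_le_cancel_iff) (auto intro!: mult_pos_pos B0)
    also have "\<dots> = ln B + N * ln r + ln (max_modulus g (\<theta>' * r))"
      using elim B0 by (simp add: ln_mult ln_realpow)
    finally show ?case .
  qed
  then show "\<exists>K m. \<forall>\<^sub>F r in at_top.
     ln (max_modulus f r) \<le> K + m * ln r + ln (max_modulus g (\<theta>' * r))" by blast
qed

text \<open>
  Only the lower bound is required with the exact exponent; the upper bound may lose an arbitrarily
  small power of \<open>r\<close>, which suffices for the order and is much easier to obtain for \<open>G_fun\<close>.
\<close>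

lemma growth_order_eqI:
  assumes \<rho>: "0 < \<rho>" and c: "0 < c" and lo: "\<forall>\<^sub>F r in at_top. c * r powr \<rho> \<le> ln (max_modulus f r)"
    and up: "\<And>\<epsilon>. 0 < \<epsilon> \<Longrightarrow> \<exists>C. \<forall>\<^sub>F r in at_top. ln (max_modulus f r) \<le> C * r powr (\<rho> + \<epsilon>)"
  shows "growth_order f = ereal \<rho>"
proof (rule antisym)
  have lim: "((\<lambda>r. ereal ((ln C + s * ln r) / ln r)) \<longlongrightarrow> ereal s) at_top" for C s :: real
  proof -
    have "((\<lambda>r. (ln C + s * ln r) / ln r) \<longlongrightarrow> s) at_top" by real_asymp
    then show ?thesis by simp
  qed
  show "growth_order f \<le> ereal \<rho>"
  proof (rule ereal_le_epsilon2)
    fix \<epsilon> :: real assume \<epsilon>: "0 < \<epsilon>"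
    then obtain C where C: "\<forall>\<^sub>F r in at_top. ln (max_modulus f r) \<le> C * r powr (\<rho> + \<epsilon>)" using up by blast
    have "\<forall>\<^sub>F r in at_top. ereal (ln (ln (max_modulus f r)) / ln r)
        \<le> ereal ((ln (max C 1) + (\<rho> + \<epsilon>) * ln r) / ln r)"
      using C lo eventually_gt_at_top[of 1]
    proof eventually_elim
      case (elim r)
      have p: "0 < ln (max_modulus f r)" using elim c by (auto intro: less_le_trans[rotated])
      have "C * r powr (\<rho> + \<epsilon>) \<le> max C 1 * r powr (\<rho> + \<epsilon>)" by (intro mult_right_mono) auto
      then have "ln (ln (max_modulus f r)) \<le> ln (max C 1 * r powr (\<rho> + \<epsilon>))"
        using elim(1) p by (subst ln_le_cancel_iff) linarith+
      also have "\<dots> = ln (max C 1) + (\<rho> + \<epsilon>) * ln r" using elim by (subst ln_mult) (auto simp: ln_powr)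
      finally show ?case using elim by (simp add: divide_right_mono)
    qed
    then have "growth_order f \<le> Limsup at_top (\<lambda>r::real. ereal ((ln (max C 1) + (\<rho> + \<epsilon>) * ln r) / ln r))"
      unfolding growth_order_def by (rule Limsup_mono)
    also have "\<dots> = ereal (\<rho> + \<epsilon>)" by (intro lim_imp_Limsup lim) simp
    finally show "growth_order f \<le> ereal \<rho> + ereal \<epsilon>" by simp
  qed
  have "ereal \<rho> = Limsup at_top (\<lambda>r::real. ereal ((ln c + \<rho> * ln r) / ln r))"
    by (rule lim_imp_Limsup[symmetric]) (simp, rule lim)
  also have "\<dots> \<le> growth_order f"
    unfolding growth_order_def
  proof (rule Limsup_mono)
    show "\<forall>\<^sub>F r in at_top. ereal ((ln c + \<rho> * ln r) / ln r) \<le> ereal (ln (ln (max_modulus f r)) / ln r)"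
      using lo eventually_gt_at_top[of 1]
    proof eventually_elim
      case (elim r)
      have "ln (c * r powr \<rho>) \<le> ln (ln (max_modulus f r))"
        using elim c by (subst ln_le_cancel_iff) (auto intro: less_le_trans[rotated])
      moreover have "ln (c * r powr \<rho>) = ln c + \<rho> * ln r" using elim c by (subst ln_mult) (auto simp: ln_powr)
      ultimately show ?case using elim by (simp add: divide_right_mono)
    qed
  qed
  finally show "ereal \<rho> \<le> growth_order f" .
qed

lemma log_dominated_upper_bound:
  assumes "log_dominated \<kappa> f g" "0 < \<kappa>" "0 < \<sigma>" "\<forall>\<^sub>F r in at_top. ln (max_modulus g r) \<le> C * r powr \<sigma>"
  shows "\<exists>C. \<forall>\<^sub>F r in at_top. ln (max_modulus f r) \<le> C * r powr \<sigma>"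
proof -
  define \<theta> where "\<theta> = \<kappa> + 1"
  have \<theta>: "\<kappa> < \<theta>" "0 < \<theta>" using assms(2) by (auto simp: \<theta>_def)
  obtain K m where K: "\<forall>\<^sub>F r in at_top. ln (max_modulus f r) \<le> K + m * ln r + ln (max_modulus g (\<theta> * r))"
    using assms(1) \<theta> unfolding log_dominated_def by blast
  have "filterlim (\<lambda>r. \<theta> * r) at_top at_top"
    by (intro filterlim_tendsto_pos_mult_at_top[OF tendsto_const] filterlim_ident \<theta>)
  then have "\<forall>\<^sub>F r in at_top. ln (max_modulus g (\<theta> * r)) \<le> C * (\<theta> * r) powr \<sigma>"
    using assms(4) eventually_compose_filterlim by blast
  moreover have "\<forall>\<^sub>F r in at_top. K + m * ln r \<le> r powr \<sigma>"
    using assms(3) by real_asymp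
  ultimately have "\<forall>\<^sub>F r in at_top. ln (max_modulus f r) \<le> (1 + C * \<theta> powr \<sigma>) * r powr \<sigma>"
    using K eventually_gt_at_top[of 0]
    by eventually_elim (use \<theta> in \<open>simp add: powr_mult algebra_simps\<close>)
  then show ?thesis by blast
qed

lemma log_dominated_lower_bound:
  assumes "log_dominated \<kappa> g f" "0 < \<kappa>" "0 < \<rho>" "0 < c" "\<forall>\<^sub>F r in at_top. c * r powr \<rho> \<le> ln (max_modulus g r)"
  shows "\<exists>c>0. \<forall>\<^sub>F r in at_top. c * r powr \<rho> \<le> ln (max_modulus f r)"
proof -
  define \<theta> where "\<theta> = \<kappa> + 1"
  have \<theta>: "\<kappa> < \<theta>" "0 < \<theta>" using assms(2) by (auto simp: \<theta>_def)
  obtain K m where K: "\<forall>\<^sub>F r in at_top. ln (max_modulus g r) \<le> K + m * ln r + ln (max_modulus f (\<theta> * r))"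
    using assms(1) \<theta> unfolding log_dominated_def by blast
  define c' where "c' = c * (1 / \<theta>) powr \<rho>"
  have c': "0 < c'" using assms \<theta> by (simp add: c'_def)
  have "filterlim (\<lambda>r. (1 / \<theta>) * r) at_top at_top"
    using \<theta> by (intro filterlim_tendsto_pos_mult_at_top[OF tendsto_const] filterlim_ident) auto
  then have "\<forall>\<^sub>F r in at_top. ln (max_modulus g ((1 / \<theta>) * r))
        \<le> K + m * ln ((1 / \<theta>) * r) + ln (max_modulus f (\<theta> * ((1 / \<theta>) * r)))
      \<and> c * ((1 / \<theta>) * r) powr \<rho> \<le> ln (max_modulus g ((1 / \<theta>) * r))"
    using eventually_conj[OF K assms(5)] eventually_compose_filterlim by blast
  moreover have "\<forall>\<^sub>F r in at_top. K + m * (ln (1 / \<theta>) + ln r) \<le> c' / 2 * r powr \<rho>"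
    using assms(3) c' by real_asymp
  ultimately have "\<forall>\<^sub>F r in at_top. c' / 2 * r powr \<rho> \<le> ln (max_modulus f r)"
    using eventually_gt_at_top[of 0]
  proof eventually_elim
    case (elim r)
    have "ln ((1 / \<theta>) * r) = ln (1 / \<theta>) + ln r" using elim \<theta> by (subst ln_mult) auto
    moreover have "((1 / \<theta>) * r) powr \<rho> = (1 / \<theta>) powr \<rho> * r powr \<rho>" using elim \<theta> by (subst powr_mult) auto
    moreover have "\<theta> * ((1 / \<theta>) * r) = r" using \<theta> by simp
    ultimately show ?case using elim unfolding c'_def by (simp add: algebra_simps)
  qed
  then show ?thesis using c' by (intro exI[of _ "c' / 2"]) auto
qed

text \<open>
  Substituting \<open>\<theta> * r\<close> for \<open>r\<close> multiplies the normalised logarithm by \<open>\<theta> powr \<rho>\<close>; then \<open>\<theta>\<close> tends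
  to \<open>\<kappa>\<close>.
\<close>

lemma growth_type_le:
  assumes dom: "log_dominated \<kappa> f g" and \<kappa>: "0 < \<kappa>" and \<rho>: "0 < \<rho>"
    and ord: "growth_order f = ereal \<rho>" "growth_order g = ereal \<rho>"
    and nn: "\<forall>\<^sub>F r in at_top. 0 \<le> ln (max_modulus g r)"
  shows "growth_type f \<le> ereal (\<kappa> powr \<rho>) * growth_type g"
proof -
  have nn': "\<forall>\<^sub>F r in at_top. ereal 0 \<le> ereal (ln (max_modulus g r) / r powr \<rho>)"
    using nn by eventually_elim auto
  have "(0::ereal) = Limsup at_top (\<lambda>r::real. ereal 0)"
    by (simp add: Limsup_const)
  also have "\<dots> \<le> growth_type g"
    unfolding growth_type_def ord using Limsup_mono[OF nn'] by simp
  finally have T0: "0 \<le> growth_type g" .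
  show ?thesis
  proof (cases "growth_type g")
    case PInf
    then show ?thesis using \<kappa> by simp
  next
    case MInf
    then show ?thesis using T0 by simp
  next
    case (real T)
    have "growth_type f \<le> ereal (\<kappa> powr \<rho> * T) + ereal \<epsilon>" if \<epsilon>: "0 < \<epsilon>" for \<epsilon>
    proof -
      have "((\<lambda>x. (\<kappa> + x) powr \<rho> * (T + x)) \<longlongrightarrow> (\<kappa> + 0) powr \<rho> * (T + 0)) (at_right 0)"
        using \<kappa> by (intro tendsto_intros) auto
      then have "\<forall>\<^sub>F x in at_right 0. (\<kappa> + x) powr \<rho> * (T + x) < \<kappa> powr \<rho> * T + \<epsilon>"
        using \<epsilon> by (intro order_tendstoD(2)[of _ "\<kappa> powr \<rho> * T"]) auto
      then obtain x where x: "0 < x" "(\<kappa> + x) powr \<rho> * (T + x) < \<kappa> powr \<rho> * T + \<epsilon>"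
        using eventually_happens[OF eventually_conj[OF _ eventually_at_right_less[of "0::real"]]] by auto
      define \<theta> where "\<theta> = \<kappa> + x"
      have \<theta>: "\<kappa> < \<theta>" "0 < \<theta>" using x \<kappa> by (auto simp: \<theta>_def)
      obtain K m where K: "\<forall>\<^sub>F r in at_top. ln (max_modulus f r) \<le> K + m * ln r + ln (max_modulus g (\<theta> * r))"
        using dom \<theta> unfolding log_dominated_def by blast
      have "growth_type g < ereal (T + x)" using real x by simp
      then have "\<forall>\<^sub>F r in at_top. ereal (ln (max_modulus g r) / r powr \<rho>) < ereal (T + x)"
        unfolding growth_type_def ord by (simp only: real_of_ereal.simps Limsup_lessD)
      then have lt: "\<forall>\<^sub>F r in at_top. ln (max_modulus g r) / r powr \<rho> < T + x" by simp
      have "filterlim (\<lambda>r. \<theta> * r) at_top at_top"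
        by (intro filterlim_tendsto_pos_mult_at_top[OF tendsto_const] filterlim_ident \<theta>)
      then have "\<forall>\<^sub>F r in at_top. ln (max_modulus g (\<theta> * r)) / (\<theta> * r) powr \<rho> < T + x"
        using lt eventually_compose_filterlim by blast
      then have le: "\<forall>\<^sub>F r in at_top. ereal (ln (max_modulus f r) / r powr \<rho>)
           \<le> ereal ((K + m * ln r) / r powr \<rho> + \<theta> powr \<rho> * (T + x))"
        using K eventually_gt_at_top[of 0]
      proof eventually_elim
        case (elim r)
        have "ln (max_modulus g (\<theta> * r)) \<le> (T + x) * (\<theta> powr \<rho> * r powr \<rho>)"
          using elim \<theta> by (simp add: field_simps powr_mult)
        then have "ln (max_modulus f r) \<le> K + m * ln r + (T + x) * (\<theta> powr \<rho> * r powr \<rho>)"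
          using elim by linarith
        then show ?case using elim by (simp add: field_simps)
      qed
      have "((\<lambda>r. (K + m * ln r) / r powr \<rho> + \<theta> powr \<rho> * (T + x)) \<longlongrightarrow> 0 + \<theta> powr \<rho> * (T + x)) at_top"
        by (intro tendsto_add tendsto_const) (use \<rho> in real_asymp)
      then have "Limsup at_top (\<lambda>r. ereal ((K + m * ln r) / r powr \<rho> + \<theta> powr \<rho> * (T + x)))
          = ereal (\<theta> powr \<rho> * (T + x))"
        by (intro lim_imp_Limsup) auto
      with Limsup_mono[OF le] have "growth_type f \<le> ereal (\<theta> powr \<rho> * (T + x))"
        unfolding growth_type_def ord by simp
      also have "\<dots> \<le> ereal (\<kappa> powr \<rho> * T) + ereal \<epsilon>" using x by (simp add: \<theta>_def)
      finally show ?thesis .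
    qed
    then have "growth_type f \<le> ereal (\<kappa> powr \<rho> * T)" by (rule ereal_le_epsilon2)
    then show ?thesis using real by simp
  qed
qed

text \<open>
  Mutual domination with reciprocal factors makes the comparison of types an equality. Growth bounds
  for \<open>g\<close> alone suffice, as domination carries the upper one to \<open>f\<close> in one direction and the lower
  one in the other.
\<close>

lemma growth_transfer:
  assumes dom: "log_dominated \<kappa> f g" "log_dominated (1 / \<kappa>) g f" and \<kappa>: "0 < \<kappa>" and \<rho>: "0 < \<rho>"
    and c: "0 < c" and lo: "\<forall>\<^sub>F r in at_top. c * r powr \<rho> \<le> ln (max_modulus g r)"
    and up: "\<And>\<epsilon>. 0 < \<epsilon> \<Longrightarrow> \<exists>C. \<forall>\<^sub>F r in at_top. ln (max_modulus g r) \<le> C * r powr (\<rho> + \<epsilon>)"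
  shows "growth_order f = ereal \<rho>" "growth_type f = ereal (\<kappa> powr \<rho>) * growth_type g"
proof -
  have \<kappa>': "0 < 1 / \<kappa>" using \<kappa> by simp
  obtain c' where c': "0 < c'" "\<forall>\<^sub>F r in at_top. c' * r powr \<rho> \<le> ln (max_modulus f r)"
    using log_dominated_lower_bound[OF dom(2) \<kappa>' \<rho> c lo] by blast
  have g: "growth_order g = ereal \<rho>" by (rule growth_order_eqI[OF \<rho> c lo up])
  show f: "growth_order f = ereal \<rho>"
  proof (rule growth_order_eqI[OF \<rho> c'])
    fix \<epsilon> :: real assume "0 < \<epsilon>"
    then show "\<exists>C. \<forall>\<^sub>F r in at_top. ln (max_modulus f r) \<le> C * r powr (\<rho> + \<epsilon>)"
      using up[of \<epsilon>] log_dominated_upper_bound[OF dom(1) \<kappa>, of "\<rho> + \<epsilon>"] \<rho> by force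
  qed
  have "growth_type f \<le> ereal (\<kappa> powr \<rho>) * growth_type g"
    using lo by (intro growth_type_le[OF dom(1) \<kappa> \<rho> f g])
      (auto elim!: eventually_mono intro: order_trans[rotated] simp: c less_imp_le)
  moreover have "growth_type g \<le> ereal ((1 / \<kappa>) powr \<rho>) * growth_type f"
    using c' by (intro growth_type_le[OF dom(2) \<kappa>' \<rho> g f])
      (auto elim!: eventually_mono intro: order_trans[rotated] simp: less_imp_le)
  moreover have "(1 / \<kappa>) powr \<rho> = 1 / \<kappa> powr \<rho>" using \<kappa> by (simp add: powr_divide)
  moreover have "0 < \<kappa> powr \<rho>" using \<kappa> by simp
  ultimately show "growth_type f = ereal (\<kappa> powr \<rho>) * growth_type g"
    by (cases "growth_type f"; cases "growth_type g") (auto simp: field_simps)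
qed

section \<open>Growth of the comparison function\<close>

text \<open>
  The shift by one makes the index \<open>k \<ge> 0\<close> correspond to the summation index \<open>k + 1\<close> of
  \<open>gamma_coeff\<close>.
\<close>

definition power_weight :: "nat \<Rightarrow> nat \<Rightarrow> real" where
  "power_weight p k = real (Suc k) powr (- (real p / 2))"

text \<open>
  Bounding the last entry bounds all entries. The empty chain, which has no last entry, is counted
  for every \<open>N\<close>.
\<close>

definition chains_upto :: "nat \<Rightarrow> nat \<Rightarrow> (nat \<Rightarrow> nat) set" where
  "chains_upto n N = {k \<in> alternating_chains n. 0 < n \<longrightarrow> k (2 * n) \<le> N}"

text \<open>
  This lemma and the next one are the two directions of the bijection between chains of length
  \<open>n + 1\<close> and chains of length \<open>n\<close> followed by a pair, which underlies the recursion of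
  \<open>chain_coeff\<close>.
\<close>

lemma extend_chain:
  assumes c: "c \<in> chains_upto n i" and ij: "i \<le> j" "j < N"
  shows "c(2 * n + 1 := Suc i, 2 * n + 2 := Suc j) \<in> chains_upto (Suc n) N" (is "?c \<in> _")
proof -
  have c1: "\<And>m. m \<in> {1..2 * n} \<Longrightarrow> 1 \<le> c m" "\<And>m. m \<notin> {1..2 * n} \<Longrightarrow> c m = undefined"
      "\<And>m. m \<in> {1..n} \<Longrightarrow> c (2 * m - 1) \<le> c (2 * m)"
      "\<And>m. m \<in> {1..<n} \<Longrightarrow> c (2 * m) < c (2 * m + 1)" "0 < n \<Longrightarrow> c (2 * n) \<le> i"
    using c by (auto simp: chains_upto_def alternating_chains_def PiE_iff extensional_def)
  have eq: "?c m = c m" if "m \<le> 2 * n" for m using that by simp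
  have "?c \<in> {1..2 * Suc n} \<rightarrow>\<^sub>E {1..}"
    using c1(1,2) by (auto simp: PiE_iff extensional_def)
  moreover have "?c (2 * m - 1) \<le> ?c (2 * m)" if "m \<in> {1..Suc n}" for m
  proof (cases "m = Suc n")
    case False
    then have "m \<in> {1..n}" using that by auto
    then have "2 * m - 1 \<le> 2 * n" "2 * m \<le> 2 * n" "c (2 * m - 1) \<le> c (2 * m)"
      using c1(3)[of m] by auto
    then show ?thesis by (simp only: eq)
  qed (use ij in simp)
  moreover have "?c (2 * m) < ?c (2 * m + 1)" if "m \<in> {1..<Suc n}" for m
  proof (cases "m = n")
    case True
    then show ?thesis using that c1(5) by simp
  next
    case False
    then have "m \<in> {1..<n}" using that by auto
    then show ?thesis using c1(4)[of m] eq[of "2 * m + 1"] eq[of "2 * m"] by simp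
  qed
  ultimately show ?thesis using ij unfolding chains_upto_def alternating_chains_def by simp
qed

lemma split_chain:
  assumes k: "k \<in> chains_upto (Suc n) N"
  shows "k(2 * n + 1 := undefined, 2 * n + 2 := undefined) \<in> chains_upto n (k (2 * n + 1) - 1)"
    and "1 \<le> k (2 * n + 1)" "k (2 * n + 1) \<le> k (2 * n + 2)" "k (2 * n + 2) \<le> N"
proof -
  have k1: "\<And>m. m \<in> {1..2 * n + 2} \<Longrightarrow> 1 \<le> k m" "\<And>m. m \<notin> {1..2 * n + 2} \<Longrightarrow> k m = undefined"
      "\<And>m. m \<in> {1..Suc n} \<Longrightarrow> k (2 * m - 1) \<le> k (2 * m)"
      "\<And>m. m \<in> {1..<Suc n} \<Longrightarrow> k (2 * m) < k (2 * m + 1)" "k (2 * n + 2) \<le> N"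
    using k by (auto simp: chains_upto_def alternating_chains_def PiE_iff extensional_def)
  let ?c = "k(2 * n + 1 := undefined, 2 * n + 2 := undefined)"
  have eq: "?c m = k m" if "m \<le> 2 * n" for m using that by simp
  have "?c \<in> {1..2 * n} \<rightarrow>\<^sub>E {1..}"
    using k1(1,2) by (auto simp: PiE_iff extensional_def)
  moreover have "?c (2 * m - 1) \<le> ?c (2 * m)" if "m \<in> {1..n}" for m
  proof -
    have "2 * m - 1 \<le> 2 * n" "2 * m \<le> 2 * n" "k (2 * m - 1) \<le> k (2 * m)"
      using that k1(3)[of m] by auto
    then show ?thesis by (simp only: eq)
  qed
  moreover have "?c (2 * m) < ?c (2 * m + 1)" if "m \<in> {1..<n}" for m
    using that k1(4)[of m] eq[of "2 * m + 1"] eq[of "2 * m"] by simp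
  moreover have "?c (2 * n) \<le> k (2 * n + 1) - 1" if "0 < n"
    using that k1(4)[of n] eq[of "2 * n"] by simp
  ultimately show "?c \<in> chains_upto n (k (2 * n + 1) - 1)"
    unfolding chains_upto_def alternating_chains_def by simp
  show "1 \<le> k (2 * n + 1)" "k (2 * n + 1) \<le> k (2 * n + 2)" "k (2 * n + 2) \<le> N"
    using k1(1)[of "2 * n + 1"] k1(3)[of "Suc n"] k1(5) by simp_all
qed

lemma chains_upto_0: "chains_upto 0 N = {\<lambda>_. undefined}"
  unfolding chains_upto_def alternating_chains_def by (simp add: PiE_empty_domain)

lemma finite_chains_upto: "finite (chains_upto n N)"
proof (induction n arbitrary: N)
  case (Suc n)
  let ?T = "SIGMA j:{..<N}. SIGMA i:{..j}. chains_upto n i"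
  have "chains_upto (Suc n) N \<subseteq> (\<lambda>(j, i, c). c(2 * n + 1 := Suc i, 2 * n + 2 := Suc j)) ` ?T"
  proof
    fix k assume k: "k \<in> chains_upto (Suc n) N"
    note s = split_chain[OF k]
    show "k \<in> (\<lambda>(j, i, c). c(2 * n + 1 := Suc i, 2 * n + 2 := Suc j)) ` ?T"
      by (rule image_eqI[of _ _ "(k (2 * n + 2) - 1, k (2 * n + 1) - 1,
             k(2 * n + 1 := undefined, 2 * n + 2 := undefined))"])
         (use s in \<open>auto simp: fun_eq_iff\<close>)
  qed
  moreover have "finite ?T" using Suc by (intro finite_SigmaI) auto
  ultimately show ?case using finite_surj by blast
qed (simp add: chains_upto_0)

lemma chain_coeff_power_weight:
  "chain_coeff (power_weight p) (power_weight p) (\<lambda>_. 1) n N =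
     (\<Sum>k\<in>chains_upto n N. (\<Prod>i=1..2 * n. real (k i)) powr (- (real p / 2)))"
proof (induction n arbitrary: N)
  case 0
  show ?case by (simp add: chains_upto_0)
next
  case (Suc n)
  let ?w = "power_weight p"
  let ?t = "\<lambda>n k. (\<Prod>i=1..2 * n. real (k i)) powr (- (real p / 2))"
  let ?T = "SIGMA j:{..<N}. SIGMA i:{..j}. chains_upto n i"
  have "(\<Sum>k\<in>chains_upto (Suc n) N. ?t (Suc n) k) = (\<Sum>(j, i, c)\<in>?T. ?w j * (?w i * ?t n c))"
  proof (rule sum.reindex_bij_witness
      [where i = "\<lambda>(j, i, c). c(2 * n + 1 := Suc i, 2 * n + 2 := Suc j)"
         and j = "\<lambda>k. (k (2 * n + 2) - 1, k (2 * n + 1) - 1,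
             k(2 * n + 1 := undefined, 2 * n + 2 := undefined))"])
    fix k assume k: "k \<in> chains_upto (Suc n) N"
    note s = split_chain[OF k]
    show "(case (k (2 * n + 2) - 1, k (2 * n + 1) - 1,
             k(2 * n + 1 := undefined, 2 * n + 2 := undefined)) of
          (j, i, c) \<Rightarrow> c(2 * n + 1 := Suc i, 2 * n + 2 := Suc j)) = k"
      using s by (auto simp: fun_eq_iff)
    show "(k (2 * n + 2) - 1, k (2 * n + 1) - 1,
             k(2 * n + 1 := undefined, 2 * n + 2 := undefined)) \<in> ?T"
      using s by auto
    have "(\<Prod>i=1..2 * Suc n. real (k i)) = (\<Prod>i=1..2 * n. real (k i)) * real (k (2 * n + 1)) * real (k (2 * n + 2))"
      by simp
    also have "(\<Prod>i=1..2 * n. real (k i))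
        = (\<Prod>i=1..2 * n. real ((k(2 * n + 1 := undefined, 2 * n + 2 := undefined)) i))"
      by (intro prod.cong) auto
    finally show "(case (k (2 * n + 2) - 1, k (2 * n + 1) - 1,
             k(2 * n + 1 := undefined, 2 * n + 2 := undefined)) of
          (j, i, c) \<Rightarrow> ?w j * (?w i * ?t n c)) = ?t (Suc n) k"
      using s by (simp add: power_weight_def powr_mult prod_nonneg mult_ac)
  next
    fix b assume b: "b \<in> ?T"
    obtain j i c where [simp]: "b = (j, i, c)" by (cases b)
    have ij: "j < N" "i \<le> j" "c \<in> chains_upto n i" using b by auto
    have u: "c m = undefined" if "2 * n < m" for m
      using ij(3) that by (auto simp: chains_upto_def alternating_chains_def PiE_iff extensional_def)
    show "(\<lambda>k. (k (2 * n + 2) - 1, k (2 * n + 1) - 1,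
             k(2 * n + 1 := undefined, 2 * n + 2 := undefined)))
         (case b of (j, i, c) \<Rightarrow> c(2 * n + 1 := Suc i, 2 * n + 2 := Suc j)) = b"
      by (auto simp: fun_eq_iff u)
    show "(case b of (j, i, c) \<Rightarrow> c(2 * n + 1 := Suc i, 2 * n + 2 := Suc j)) \<in> chains_upto (Suc n) N"
      using extend_chain ij by simp
  qed
  also have "\<dots> = (\<Sum>j<N. \<Sum>i\<le>j. \<Sum>c\<in>chains_upto n i. ?w j * (?w i * ?t n c))"
    by (simp add: sum.Sigma finite_SigmaI finite_chains_upto)
  also have "\<dots> = chain_coeff ?w ?w (\<lambda>_. 1) (Suc n) N"
    by (simp add: Suc.IH sum_distrib_left)
  finally show ?case by simp
qed

lemma chain_weights_power_weight:
  assumes "2 < p"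
  shows "chain_weights (power_weight p) (power_weight p)"
proof (rule chain_weightsI)
  show "(\<lambda>k. power_weight p k * real (Suc k) powr (real p / 2)) \<longlonglongrightarrow> 1"
    "(\<lambda>k. power_weight p k * real (Suc k) powr (real p / 2)) \<longlonglongrightarrow> 1"
    by (simp_all add: power_weight_def powr_add[symmetric])
qed (use assms in \<open>auto simp: power_weight_def\<close>)

text \<open>
  All terms are nonnegative and every finite set of chains lies in some \<open>chains_upto n N\<close>, so the
  unconditional sum is the supremum of the truncated ones.
\<close>

lemma gamma_coeff_eq_chain_total:
  assumes "2 < p"
  shows "gamma_coeff p n = chain_total (power_weight p) (power_weight p) n"
proof -
  interpret chain_weights "power_weight p" "power_weight p"
    by (rule chain_weights_power_weight[OF assms])
  let ?t = "\<lambda>k. (\<Prod>i=1..2 * n. real (k i)) powr (- (real p / 2))"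
  let ?A = "alternating_chains n" and ?\<gamma> = "chain_total (power_weight p) (power_weight p) n"
  have fin: "sum ?t F \<le> ?\<gamma>" if F: "F \<subseteq> ?A" "finite F" for F
  proof -
    define N where "N = (\<Sum>k\<in>F. k (2 * n))"
    have "F \<subseteq> chains_upto n N"
      using F by (auto simp: chains_upto_def N_def intro!: member_le_sum)
    then have "sum ?t F \<le> sum ?t (chains_upto n N)"
      by (intro sum_mono2 finite_chains_upto) auto
    then show ?thesis
      using chain_coeff_le_total[of n N] by (simp add: chain_coeff_power_weight)
  qed
  have S: "?t summable_on ?A"
  proof (rule nonneg_bdd_above_summable_on)
    show "bdd_above (sum ?t ` {F. F \<subseteq> ?A \<and> finite F})" using fin by (auto intro!: bdd_aboveI)
  qed simp
  show ?thesis unfolding gamma_coeff_def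
  proof (rule antisym)
    show "infsum ?t ?A \<le> ?\<gamma>" by (rule infsum_le_finite_sums[OF S]) (use fin in auto)
    show "?\<gamma> \<le> infsum ?t ?A"
    proof (rule chain_total_least)
      fix N
      show "chain_coeff (power_weight p) (power_weight p) (\<lambda>_. 1) n N \<le> infsum ?t ?A"
        unfolding chain_coeff_power_weight
        by (rule finite_sum_le_infsum[OF S finite_chains_upto]) (auto simp: chains_upto_def)
    qed
  qed
qed

text \<open>
  The single chain \<open>1 \<le> 1 < 2 \<le> 2 < \<cdots> < n \<le> n\<close> already contributes this much.
\<close>

lemma gamma_lower_bound:
  assumes "2 < p"
  shows "1 / fact n ^ p \<le> chain_total (power_weight p) (power_weight p) n"
proof -
  interpret chain_weights "power_weight p" "power_weight p"
    by (rule chain_weights_power_weight[OF assms])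
  let ?f = "chain_coeff (power_weight p) (power_weight p) (\<lambda>_. 1)"
  have "1 / fact n ^ p \<le> ?f n n"
  proof (induction n)
    case (Suc n)
    have sq: "power_weight p n * power_weight p n = 1 / real (Suc n) ^ p"
      by (simp add: power_weight_def powr_add[symmetric] powr_minus powr_realpow field_simps)
    have "1 / fact (Suc n) ^ p = power_weight p n * (power_weight p n * (1 / fact n ^ p))"
      unfolding mult.assoc[symmetric] sq by (simp add: power_mult_distrib)
    also have "\<dots> \<le> power_weight p n * (power_weight p n * ?f n n)"
      by (intro mult_left_mono Suc nonneg)
    also have "\<dots> \<le> power_weight p n * (\<Sum>k\<le>n. power_weight p k * ?f n k)"
      by (intro mult_left_mono nonneg member_le_sum) (auto intro!: mult_nonneg_nonneg nonneg chain_coeff_const_nonneg)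
    also have "\<dots> \<le> ?f (Suc n) (Suc n)"
      unfolding chain_coeff.simps
      by (intro member_le_sum[of n "{..<Suc n}" "\<lambda>j. power_weight p j * (\<Sum>k\<le>j. power_weight p k * ?f n k)"])
         (auto intro!: mult_nonneg_nonneg sum_nonneg nonneg chain_coeff_const_nonneg)
    finally show ?case .
  qed simp
  also have "\<dots> \<le> chain_total (power_weight p) (power_weight p) n" by (rule chain_coeff_le_total)
  finally show ?thesis .
qed

text \<open>
  Every index occurs at most twice in a chain, and the chain is determined by these multiplicities,
  so expanding the product dominates the sum over chains. In the proof this is an induction for the
  pair formed by \<open>F\<^sub>N\<close> and its scaled flux \<open>U\<^sub>N\<close>: one step is multiplication by a nonnegative
  \<open>2 \<times> 2\<close> matrix with row sums at most \<open>1 + y + y\<^sup>2\<close>.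
\<close>

lemma chain_poly_le_prod:
  assumes nn: "\<And>k. 0 \<le> x k" and w: "0 \<le> w"
  shows "chain_poly x x (\<lambda>_. 1) N w \<le> (\<Prod>k<N. 1 + sqrt w * x k + (sqrt w * x k)\<^sup>2)"
proof -
  define y where "y k = sqrt w * x k" for k
  define F where "F N = chain_poly x x (\<lambda>_. 1) N w" for N
  \<comment> \<open>\<open>U N\<close> is the flux through the gap before \<open>N\<close>, divided by \<open>sqrt w\<close>.\<close>
  define U where "U N = (\<Sum>k<N. y k * F k)" for N
  define P where "P N = (\<Prod>k<N. 1 + y k + (y k)\<^sup>2)" for N
  have y0: "0 \<le> y k" for k using nn w by (simp add: y_def)
  have P0: "0 \<le> P N" for N unfolding P_def using y0 by (intro prod_nonneg) (auto intro!: add_nonneg_nonneg)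
  have Frec: "F N = 1 + w * (\<Sum>j<N. x j * (\<Sum>k\<le>j. x k * F k))" for N
    unfolding F_def by (subst chain_poly_rec) simp
  have ww: "w = sqrt w * sqrt w" using w by simp
  have FS: "F (Suc N) = F N + y N * (U N + y N * F N)" for N
  proof -
    have "F (Suc N) = F N + w * (x N * (\<Sum>k\<le>N. x k * F k))"
      by (subst (1 2) Frec) (simp add: algebra_simps)
    also have "w * (x N * (\<Sum>k\<le>N. x k * F k)) = y N * (\<Sum>k\<le>N. y k * F k)"
    proof -
      have "(\<Sum>k\<le>N. y k * F k) = sqrt w * (\<Sum>k\<le>N. x k * F k)"
        by (simp add: y_def sum_distrib_left mult_ac)
      then have "y N * (\<Sum>k\<le>N. y k * F k) = (sqrt w * sqrt w) * (x N * (\<Sum>k\<le>N. x k * F k))"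
        by (simp only: y_def mult_ac)
      then show ?thesis by (simp only: ww[symmetric])
    qed
    also have "(\<Sum>k\<le>N. y k * F k) = U N + y N * F N"
      by (simp add: U_def lessThan_Suc_atMost[symmetric])
    finally show ?thesis .
  qed
  have "F N \<le> P N \<and> U N \<le> P N"
  proof (induction N)
    case 0
    then show ?case by (subst Frec) (simp add: U_def P_def)
  next
    case (Suc N)
    have P: "P (Suc N) = P N + y N * P N + y N * (y N * P N)"
      by (simp add: P_def algebra_simps power2_eq_square)
    have "y N * F N \<le> y N * P N" using Suc y0 by (intro mult_left_mono) auto
    moreover have "y N * (U N + y N * F N) \<le> y N * (P N + y N * P N)"
      using Suc y0 by (intro mult_left_mono add_mono) auto
    moreover have "0 \<le> y N * (y N * P N)" using y0 P0 by simp
    ultimately show ?case using Suc unfolding P FS by (auto simp: U_def algebra_simps)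
  qed
  then show ?thesis by (simp add: F_def P_def y_def)
qed

text \<open>
  For \<open>y \<le> 1\<close> the left-hand side is at most \<open>exp (2 * y)\<close>, and \<open>y \<le> y powr \<theta>\<close>; for \<open>y > 1\<close> its
  logarithm is \<open>O(1 + ln y)\<close>, and \<open>ln y\<close> is below \<open>y powr \<theta> / \<theta>\<close>.
\<close>

lemma quadratic_le_exp_powr:
  fixes y \<theta> :: real
  assumes y: "0 \<le> y" and \<theta>: "0 < \<theta>" "\<theta> \<le> 1"
  shows "1 + y + y\<^sup>2 \<le> exp ((2 + 2 / \<theta>) * y powr \<theta>)"
proof (cases "y \<le> 1")
  case True
  have le: "y \<le> y powr \<theta>" using True y \<theta> powr_mono'[of \<theta> 1 y] by auto
  have "1 + y + y\<^sup>2 \<le> 1 + 2 * y" using True y by (simp add: power2_eq_square mult_left_le)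
  also have "\<dots> \<le> exp (2 * y)" by (rule exp_ge_add_one_self)
  also have "\<dots> \<le> exp ((2 + 2 / \<theta>) * y powr \<theta>)"
  proof -
    have "2 * y \<le> 2 * y powr \<theta>" using le by simp
    also have "\<dots> \<le> (2 + 2 / \<theta>) * y powr \<theta>" using \<theta> by (intro mult_right_mono) auto
    finally show ?thesis by simp
  qed
  finally show ?thesis .
next
  case False
  then have y1: "1 < y" by simp
  define Y where "Y = y powr \<theta>"
  have Y1: "1 \<le> Y" unfolding Y_def using y1 \<theta> by (intro ge_one_powr_ge_zero) auto
  have "\<theta> * ln y = ln Y" using y1 by (simp add: Y_def ln_powr)
  also have "\<dots> \<le> Y - 1" using Y1 by (intro ln_le_minus_one) auto
  finally have lny: "2 * ln y \<le> 2 / \<theta> * Y" using \<theta> by (simp add: field_simps)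
  have "1 + y + y\<^sup>2 \<le> 3 * y\<^sup>2" using y1 by (simp add: power2_eq_square) (smt (verit) mult_le_cancel_left1)
  also have "\<dots> \<le> exp 2 * exp (2 * ln y)"
  proof -
    have "3 \<le> exp (2::real)" using exp_ge_add_one_self[of "2::real"] by simp
    moreover have "exp (2 * ln y) = y\<^sup>2" using y1 by (simp add: exp_double)
    ultimately show ?thesis using y1 by (simp add: mult_right_mono)
  qed
  also have "\<dots> \<le> exp (2 * Y) * exp (2 / \<theta> * Y)"
    using lny Y1 by (intro mult_mono) auto
  also have "\<dots> = exp ((2 + 2 / \<theta>) * Y)" by (simp add: exp_add[symmetric] algebra_simps)
  finally show ?thesis by (simp add: Y_def)
qed

text \<open>
  The condition \<open>2 / p < \<theta>\<close> is exactly what makes \<open>\<Sum>k. power_weight p k powr \<theta>\<close> converge; as \<open>\<theta>\<close>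
  tends to \<open>2 / p\<close> the exponent of \<open>w\<close> tends to the order \<open>1 / p\<close>.
\<close>

lemma gamma_upper_bound:
  assumes p: "2 < p" and \<theta>: "2 / p < \<theta>" "\<theta> \<le> 1"
  shows "\<exists>K. \<forall>n. \<forall>w>0. chain_total (power_weight p) (power_weight p) n * w ^ n \<le> exp (K * w powr (\<theta> / 2))"
proof -
  interpret chain_weights "power_weight p" "power_weight p"
    by (rule chain_weights_power_weight[OF p])
  let ?x = "power_weight p" and ?f = "chain_coeff (power_weight p) (power_weight p) (\<lambda>_. 1)"
  have \<theta>0: "0 < \<theta>" using \<theta>(1) by (rule le_less_trans[rotated]) simp
  have sm: "summable (\<lambda>k. ?x k powr \<theta>)"
  proof (rule summable_powr_limit)
    show "1 < real p / 2 * \<theta>" using p \<theta> by (simp add: field_simps)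
    show "(\<lambda>k. ?x k powr \<theta> * real (Suc k) powr (real p / 2 * \<theta>)) \<longlonglongrightarrow> 1"
      by (simp add: power_weight_def powr_powr powr_add[symmetric])
  qed
  define Z where "Z = (\<Sum>k. ?x k powr \<theta>)"
  define K where "K = (2 + 2 / \<theta>) * Z"
  have "?f n N * w ^ n \<le> exp (K * w powr (\<theta> / 2))" if w: "0 < w" for n N w
  proof -
    have "?f n N * w ^ n \<le> chain_poly ?x ?x (\<lambda>_. 1) N w"
    proof (cases "n \<le> N")
      case True
      then show ?thesis unfolding chain_poly_def of_real_def
        using w by (intro order_trans[OF _ member_le_sum[of n]])
           (auto intro!: mult_nonneg_nonneg chain_coeff_const_nonneg)
    next
      case False
      then show ?thesis unfolding chain_poly_def
        using w by (auto simp: chain_coeff_eq_0 intro!: sum_nonneg mult_nonneg_nonneg chain_coeff_const_nonneg)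
    qed
    also have "\<dots> \<le> (\<Prod>k<N. 1 + sqrt w * ?x k + (sqrt w * ?x k)\<^sup>2)"
      using w by (intro chain_poly_le_prod nonneg) auto
    also have "\<dots> \<le> (\<Prod>k<N. exp ((2 + 2 / \<theta>) * (sqrt w * ?x k) powr \<theta>))"
      using w nonneg \<theta>0 \<theta> by (intro prod_mono conjI quadratic_le_exp_powr) (auto intro!: add_nonneg_nonneg)
    also have "\<dots> = exp (\<Sum>k<N. (2 + 2 / \<theta>) * (sqrt w * ?x k) powr \<theta>)"
      by (simp add: exp_sum)
    also have "(\<Sum>k<N. (2 + 2 / \<theta>) * (sqrt w * ?x k) powr \<theta>)
        = (2 + 2 / \<theta>) * w powr (\<theta> / 2) * (\<Sum>k<N. ?x k powr \<theta>)"
      using w nonneg by (simp add: powr_mult sum_distrib_left mult_ac powr_half_sqrt[symmetric] powr_powr)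
    also have "\<dots> \<le> (2 + 2 / \<theta>) * w powr (\<theta> / 2) * Z"
      unfolding Z_def using \<theta>0 by (intro mult_left_mono sum_le_suminf sm) auto
    also have "\<dots> = K * w powr (\<theta> / 2)" by (simp add: K_def)
    finally show ?thesis by simp
  qed
  then have "?f n N \<le> exp (K * w powr (\<theta> / 2)) / w ^ n" if "0 < w" for n N w
    using that by (simp add: pos_le_divide_eq)
  then have "chain_total ?x ?x n \<le> exp (K * w powr (\<theta> / 2)) / w ^ n" if "0 < w" for n w
    using that by (intro chain_total_least)
  then show ?thesis by (intro exI[of _ K]) (simp add: pos_le_divide_eq)
qed

lemma summable_chain_total_power_weight:
  assumes p: "2 < p" and r: "0 \<le> r"
  shows "summable (\<lambda>n. chain_total (power_weight p) (power_weight p) n * r ^ n)"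
proof -
  let ?\<gamma> = "chain_total (power_weight p) (power_weight p)"
  interpret chain_weights "power_weight p" "power_weight p"
    by (rule chain_weights_power_weight[OF p])
  obtain K where K: "\<And>n w. 0 < w \<Longrightarrow> ?\<gamma> n * w ^ n \<le> exp (K * w powr (1 / 2))"
    using gamma_upper_bound[OF p, of 1] p by auto
  \<comment> \<open>The summand \<open>1\<close> keeps \<open>w\<close> positive when \<open>r = 0\<close>.\<close>
  define w where "w = 2 * (r + 1)"
  have w: "0 < w" "r / w \<le> 1 / 2" using r by (auto simp: w_def field_simps)
  show ?thesis
  proof (rule summable_comparison_test')
    show "summable (\<lambda>n. exp (K * w powr (1 / 2)) * (1 / 2) ^ n)"
      by (intro summable_mult summable_geometric) simp
    fix n
    have "?\<gamma> n * r ^ n = (?\<gamma> n * w ^ n) * (r / w) ^ n" using w by (simp add: power_divide)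
    also have "\<dots> \<le> exp (K * w powr (1 / 2)) * (1 / 2) ^ n"
      using w r by (intro mult_mono K power_mono) (auto intro!: mult_nonneg_nonneg chain_total_nonneg)
    finally show "norm (?\<gamma> n * r ^ n) \<le> exp (K * w powr (1 / 2)) * (1 / 2) ^ n"
      using r chain_total_nonneg by simp
  qed
qed

definition G_coeff :: "nat \<Rightarrow> nat \<Rightarrow> complex" where
  "G_coeff p n = (if n = 0 then 0 else of_real (chain_total (power_weight p) (power_weight p) n))"

lemma G_entire:
  assumes p: "2 < p"
  shows "entire_series (G_coeff p) (G_fun p)"
proof
  fix z :: complex
  let ?\<gamma> = "chain_total (power_weight p) (power_weight p)"
  interpret chain_weights "power_weight p" "power_weight p"
    by (rule chain_weights_power_weight[OF p])
  have "summable (\<lambda>n. norm (G_coeff p n * z ^ n))"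
    by (rule summable_comparison_test'[OF summable_chain_total_power_weight[OF p norm_ge_zero[of z]], of 0])
       (simp add: G_coeff_def norm_mult norm_power chain_total_nonneg)
  then have s: "summable (\<lambda>n. G_coeff p n * z ^ n)" by (rule summable_norm_cancel)
  then have "(\<Sum>n. G_coeff p n * z ^ n) = (\<Sum>n. G_coeff p (Suc n) * z ^ Suc n)"
    by (subst suminf_split_head) (simp_all add: G_coeff_def)
  also have "\<dots> = G_fun p z"
    unfolding G_fun_def by (simp add: G_coeff_def gamma_coeff_eq_chain_total[OF p])
  finally show "(\<lambda>n. G_coeff p n * z ^ n) sums G_fun p z" using s by (simp add: sums_iff)
qed

lemma G_coeff_pos:
  assumes "2 < p" "0 < n"
  shows "G_coeff p n \<noteq> 0"
proof -
  have "0 < (1 :: real) / fact n ^ p" by simp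
  then show ?thesis using gamma_lower_bound[OF assms(1), of n] assms(2) unfolding G_coeff_def
    by (metis less_le_trans less_irrefl not_less_zero of_real_eq_0_iff)
qed

lemma G_lower_growth:
  assumes p: "2 < p"
  shows "\<forall>\<^sub>F r in at_top. 1 / (2 * exp 1) * r powr (1 / p) \<le> ln (max_modulus (G_fun p) r)"
proof -
  interpret G: entire_series "G_coeff p" "G_fun p" by (rule G_entire[OF p])
  have p0: "0 < real p" using p by simp
  have "\<forall>\<^sub>F r in at_top. 2 * exp 1 \<le> r powr (1 / p)" using p0 by real_asymp
  then show ?thesis using eventually_gt_at_top[of 0]
  proof eventually_elim
    case (elim r)
    define t where "t = r powr (1 / p)"
    \<comment> \<open>For this \<open>n\<close>, \<open>ln r \<ge> p * (ln n + 1)\<close>, so \<open>r ^ n / fact n ^ p\<close> is at least \<open>exp (p * n)\<close>.\<close>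
    define n where "n = nat \<lfloor>t / exp 1\<rfloor>"
    have t: "2 \<le> t / exp 1" using elim by (simp add: t_def field_simps)
    have n: "real n \<le> t / exp 1" "t / exp 1 - 1 \<le> real n" "2 \<le> n"
      using t unfolding n_def by linarith+
    have t0: "0 < t" using elim by (simp add: t_def)
    have "ln (real n) \<le> ln (t / exp 1)" using n t0 by (subst ln_le_cancel_iff) auto
    also have "\<dots> = ln r / p - 1" using elim t0 by (simp add: ln_div) (simp add: t_def ln_powr)
    finally have lnn: "ln (real n) \<le> ln r / p - 1" .
    \<comment> \<open>The crude bound \<open>n! \<le> n ^ n\<close> affects only the constant.\<close>
    have "fact n \<le> real n ^ n" using fact_le_power[of n, where 'a = real] by simp
    then have "ln (fact n) \<le> ln (real n ^ n)" using n by (subst ln_le_cancel_iff) auto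
    also have "\<dots> = n * ln (real n)" using n by (simp add: ln_realpow)
    also have "\<dots> \<le> n * (ln r / p - 1)" using lnn by (intro mult_left_mono) auto
    finally have "p * ln (fact n) \<le> p * (n * (ln r / p - 1))" using p0 by (intro mult_left_mono) auto
    also have "\<dots> = n * ln r - p * n" using p0 by (simp add: field_simps)
    finally have f: "p * ln (fact n) \<le> n * ln r - p * n" .
    have "1 / fact n ^ p * r ^ n \<le> norm (G_coeff p n) * r ^ n"
      using gamma_lower_bound[OF p, of n] elim n by (intro mult_right_mono) (auto simp: G_coeff_def)
    also have "\<dots> \<le> max_modulus (G_fun p) r" using elim by (intro G.Cauchy_bound)
    finally have M: "1 / fact n ^ p * r ^ n \<le> max_modulus (G_fun p) r" .
    have "1 / (2 * exp 1) * t \<le> real n" using n t by (simp add: field_simps)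
    also have "\<dots> \<le> real p * n" using p n by simp
    also have "\<dots> \<le> n * ln r - p * ln (fact n)" using f by simp
    also have "\<dots> = ln (1 / fact n ^ p * r ^ n)" using elim by (simp add: ln_mult ln_div ln_realpow)
    also have "\<dots> \<le> ln (max_modulus (G_fun p) r)"
      using M elim by (subst ln_le_cancel_iff) (auto intro: less_le_trans[OF _ M])
    finally show ?case by (simp add: t_def)
  qed
qed

lemma G_upper_growth:
  assumes p: "2 < p" and \<epsilon>: "0 < \<epsilon>"
  shows "\<exists>C. \<forall>\<^sub>F r in at_top. ln (max_modulus (G_fun p) r) \<le> C * r powr (1 / p + \<epsilon>)"
proof -
  let ?\<gamma> = "chain_total (power_weight p) (power_weight p)"
  interpret chain_weights "power_weight p" "power_weight p"
    by (rule chain_weights_power_weight[OF p])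
  interpret G: entire_series "G_coeff p" "G_fun p" by (rule G_entire[OF p])
  \<comment> \<open>Chosen so that \<open>\<theta> / 2\<close> does not exceed the desired exponent.\<close>
  define \<theta> where "\<theta> = min 1 (2 / p + 2 * \<epsilon>)"
  have \<theta>: "2 / p < \<theta>" "\<theta> \<le> 1" "\<theta> / 2 \<le> 1 / p + \<epsilon>" using p \<epsilon> by (auto simp: \<theta>_def min_def)
  obtain K where K: "\<And>n w. 0 < w \<Longrightarrow> ?\<gamma> n * w ^ n \<le> exp (K * w powr (\<theta> / 2))"
    using gamma_upper_bound[OF p \<theta>(1,2)] by auto
  define C where "C = max K 0 * 2 powr (\<theta> / 2)"
  have C0: "0 \<le> C" by (simp add: C_def)
  have bound: "max_modulus (G_fun p) r \<le> exp (C * r powr (1 / p + \<epsilon>))" if r: "1 \<le> r" for r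
  proof (rule max_modulus_le)
    define B where "B = exp (K * (2 * r) powr (\<theta> / 2))"
    fix z :: complex assume z: "norm z = r"
    \<comment> \<open>The bound on \<open>\<gamma>\<^sub>n\<close> at twice the radius leaves a geometric series with ratio \<open>1/2\<close>.\<close>
    have term_le: "norm (G_coeff p (Suc n) * z ^ Suc n) \<le> B * (1 / 2) ^ Suc n" for n
    proof -
      have "norm (G_coeff p (Suc n) * z ^ Suc n) = (?\<gamma> (Suc n) * (2 * r) ^ Suc n) * (1 / 2) ^ Suc n"
        by (simp add: G_coeff_def norm_mult norm_power z chain_total_nonneg power_mult_distrib power_divide)
      also have "\<dots> \<le> B * (1 / 2) ^ Suc n"
        unfolding B_def using r by (intro mult_right_mono K) auto
      finally show ?thesis .
    qed
    have half: "(\<lambda>n. B * (1 / 2) ^ Suc n) sums (B * 1)" by (intro sums_mult power_half_series)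
    have "G_fun p z = (\<Sum>n. G_coeff p (Suc n) * z ^ Suc n)"
      using G.sums[of z] by (subst suminf_split_head) (auto simp: sums_iff G_coeff_def)
    also have "norm \<dots> \<le> (\<Sum>n. B * (1 / 2) ^ Suc n)"
      using half by (intro norm_suminf_le term_le) (auto simp: sums_iff)
    also have "\<dots> = B" using half by (simp add: sums_iff)
    also have "\<dots> \<le> exp (C * r powr (1 / p + \<epsilon>))"
    proof -
      have "K * (2 * r) powr (\<theta> / 2) \<le> max K 0 * (2 * r) powr (\<theta> / 2)"
        by (intro mult_right_mono) auto
      also have "\<dots> = C * r powr (\<theta> / 2)" using r by (simp add: C_def powr_mult)
      also have "\<dots> \<le> C * r powr (1 / p + \<epsilon>)"
        using r \<theta> C0 by (intro mult_left_mono powr_mono) auto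
      finally show ?thesis by (simp add: B_def)
    qed
    finally show "norm (G_fun p z) \<le> exp (C * r powr (1 / p + \<epsilon>))" .
  qed (use r in simp)
  have "\<forall>\<^sub>F r in at_top. ln (max_modulus (G_fun p) r) \<le> C * r powr (1 / p + \<epsilon>)"
    using G.eventually_max_modulus_ge_1[OF G_coeff_pos[OF p zero_less_one] zero_less_one]
      eventually_ge_at_top[of 1]
  proof eventually_elim
    case (elim r)
    have "ln (max_modulus (G_fun p) r) \<le> ln (exp (C * r powr (1 / p + \<epsilon>)))"
      using bound[of r] elim by (subst ln_le_cancel_iff) auto
    then show ?case by simp
  qed
  then show ?thesis by blast
qed

lemma G_growth_order:
  assumes "2 < p"
  shows "growth_order (G_fun p) = ereal (1 / p)"
  by (rule growth_order_eqI[OF _ _ G_lower_growth[OF assms] G_upper_growth[OF assms]])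
     (use assms in auto)

lemma G_has_growth_type:
  assumes "2 < p"
  shows "has_growth_type (G_fun p) (growth_type (G_fun p))"
proof -
  interpret G: entire_series "G_coeff p" "G_fun p" by (rule G_entire[OF assms])
  show ?thesis
    unfolding has_growth_type_def
    using G.holomorphic G.not_constant[OF G_coeff_pos[OF assms zero_less_one] zero_less_one] assms
    by (simp add: G_growth_order)
qed

section \<open>Series of chain polynomials\<close>

text \<open>
  This gives the Taylor expansion of the four entire functions of the moment problem: the summation
  over the index of the orthogonal polynomials and the one over the powers are interchanged by
  Tannery's theorem.
\<close>

lemma (in chain_weights) weighted_chain_poly_sums:
  fixes w :: complex
  assumes t: "\<And>k. 0 \<le> t k" "\<And>k. t k \<le> T * \<alpha> k" and h: "\<And>k. 0 \<le> h k" "\<And>k. h k \<le> H"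
    and \<phi>: "\<forall>r\<ge>0. summable (\<lambda>n. chain_total \<alpha> \<beta> n * r ^ n)"
  shows "summable (\<lambda>k. t k * chain_coeff \<alpha> \<beta> h n k)"
    and "summable (\<lambda>k. of_real (t k) * chain_poly \<alpha> \<beta> h k w)"
    and "(\<Sum>k. t k * chain_coeff \<alpha> \<beta> h n k) \<le> T * suminf \<alpha> * H * chain_total \<alpha> \<beta> n"
    and "(\<lambda>n. of_real (\<Sum>k. t k * chain_coeff \<alpha> \<beta> h n k) * w ^ n) sums
           (\<Sum>k. of_real (t k) * chain_poly \<alpha> \<beta> h k w)"
proof -
  let ?c = "chain_coeff \<alpha> \<beta> h" and ?\<phi> = "chain_total \<alpha> \<beta>"
  have H0: "0 \<le> H" using h[of 0] by linarith
  have c0: "0 \<le> ?c n k" for n k by (intro chain_coeff_nonneg nonneg h)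
  have cH: "?c n k \<le> H * ?\<phi> n" for n k
  proof -
    have "?c n k \<le> chain_coeff \<alpha> \<beta> (\<lambda>_. H * 1) n k"
      by (intro chain_coeff_mono_base nonneg) (simp add: h)
    also have "\<dots> \<le> H * ?\<phi> n"
      unfolding chain_coeff_scale using H0 by (intro mult_left_mono chain_coeff_le_total)
    finally show ?thesis .
  qed
  have tc0: "0 \<le> t k * ?c n k" for n k using t c0 by simp
  have termle: "t k * ?c n k \<le> \<alpha> k * (T * (H * ?\<phi> n))" for n k
  proof -
    have "t k * ?c n k \<le> (T * \<alpha> k) * (H * ?\<phi> n)"
      using t[of k] by (intro mult_mono cH c0) auto
    then show ?thesis by (simp add: mult_ac)
  qed
  have sm: "summable (\<lambda>k. \<alpha> k * (T * (H * ?\<phi> n)))" for n by (intro summable_mult2 summable)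
  have sum: "summable (\<lambda>k. t k * ?c n k)" for n
    by (rule summable_comparison_test'[OF sm[of n], of 0])
       (metis abs_of_nonneg real_norm_def tc0 termle)
  have total: "(\<Sum>k. \<alpha> k * (T * (H * ?\<phi> n))) = T * suminf \<alpha> * H * ?\<phi> n" for n
    by (subst suminf_mult2[OF summable(1), symmetric]) (simp add: mult_ac)
  have bound: "(\<Sum>k. t k * ?c n k) \<le> T * suminf \<alpha> * H * ?\<phi> n" for n
    unfolding total[symmetric] by (intro suminf_le sum sm termle)
  show "summable (\<lambda>k. t k * ?c n k)" "(\<Sum>k. t k * ?c n k) \<le> T * suminf \<alpha> * H * ?\<phi> n"
    by (fact sum bound)+
  define b where "b n = of_real (\<Sum>k. t k * ?c n k) * w ^ n" for n
  define a where "a n K = of_real (\<Sum>k<K. t k * ?c n k) * w ^ n" for n and K :: nat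
  define M where "M n = T * suminf \<alpha> * H * (?\<phi> n * norm w ^ n)" for n
  have "eventually (\<lambda>K. summable (\<lambda>n. norm (a n K))) sequentially \<and> summable (\<lambda>n. norm (b n)) \<and>
          ((\<lambda>K. suminf (\<lambda>n. a n K)) \<longlongrightarrow> suminf b) sequentially"
  proof (rule tannerys_theorem)
    show "((\<lambda>K. a n K) \<longlongrightarrow> b n) sequentially" for n
      unfolding a_def b_def by (intro tendsto_intros summable_LIMSEQ sum)
    show "summable M" unfolding M_def using \<phi> by (intro summable_mult) simp
    have "norm (a n K) \<le> M n" for n K
    proof -
      have "(\<Sum>k<K. t k * ?c n k) \<le> (\<Sum>k. t k * ?c n k)"
        by (intro sum_le_suminf sum) (auto simp: tc0)
      then have "(\<Sum>k<K. t k * ?c n k) \<le> T * suminf \<alpha> * H * ?\<phi> n" using bound order_trans by blast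
      moreover have "0 \<le> (\<Sum>k<K. t k * ?c n k)" by (intro sum_nonneg tc0)
      ultimately show ?thesis unfolding a_def M_def norm_mult norm_power norm_of_real
        by (simp only: abs_of_nonneg mult.assoc[symmetric] mult_right_mono zero_le_power norm_ge_zero)
    qed
    then show "eventually (\<lambda>(n, K). norm (a n K) \<le> M n) (at_top \<times>\<^sub>F sequentially)"
      by (intro always_eventually) auto
  qed simp
  then have sb: "summable b" and lim: "(\<lambda>K. suminf (\<lambda>n. a n K)) \<longlonglongrightarrow> suminf b"
    using summable_norm_cancel by auto
  have "(\<lambda>n. \<Sum>k<K. of_real (t k) * (of_real (?c n k) * w ^ n)) sums
        (\<Sum>k<K. of_real (t k) * chain_poly \<alpha> \<beta> h k w)" for K
    by (intro sums_sum sums_mult chain_poly_sums)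
  then have "suminf (\<lambda>n. a n K) = (\<Sum>k<K. of_real (t k) * chain_poly \<alpha> \<beta> h k w)" for K
    unfolding a_def of_real_sum of_real_mult sum_distrib_right mult.assoc by (simp only: sums_iff)
  then have "(\<lambda>k. of_real (t k) * chain_poly \<alpha> \<beta> h k w) sums suminf b"
    using lim by (simp add: sums_def)
  then show "summable (\<lambda>k. of_real (t k) * chain_poly \<alpha> \<beta> h k w)"
    and "(\<lambda>n. of_real (\<Sum>k. t k * ?c n k) * w ^ n) sums
           (\<Sum>k. of_real (t k) * chain_poly \<alpha> \<beta> h k w)"
    using sb unfolding b_def by (simp_all add: sums_iff)
qed

text \<open>
  The index \<open>k = 0\<close> may be left out of the lower bound for \<open>t\<close> because no chain of positive length
  ends before it. This matters since \<open>Q\<^sub>0 = 0\<close>.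
\<close>

lemma (in chain_weights) chain_total_le_weighted:
  assumes t: "\<And>k. 0 \<le> t k" "\<And>k. 0 < k \<Longrightarrow> \<alpha> k \<le> T' * t k"
    and h: "\<And>k. 0 \<le> h k" "\<And>n k. chain_coeff \<alpha> \<beta> (\<lambda>_. 1) (Suc n) k \<le> H' * chain_coeff \<alpha> \<beta> h n k"
    and sum: "\<And>n. summable (\<lambda>k. t k * chain_coeff \<alpha> \<beta> h n k)"
    and n: "0 < n"
  shows "chain_total \<alpha> \<beta> (Suc (Suc n)) \<le> suminf \<beta> * (H' * T') * (\<Sum>k. t k * chain_coeff \<alpha> \<beta> h n k)"
proof -
  let ?c = "chain_coeff \<alpha> \<beta> h"
  have "\<alpha> k * chain_coeff \<alpha> \<beta> (\<lambda>_. 1) (Suc n) k \<le> (H' * T') * (t k * ?c n k)" for k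
  proof (cases "k = 0")
    case True
    then show ?thesis using n by (simp add: chain_coeff_eq_0)
  next
    case False
    have nn: "0 \<le> H' * ?c n k" using order_trans[OF chain_coeff_const_nonneg h(2)] .
    have "\<alpha> k * chain_coeff \<alpha> \<beta> (\<lambda>_. 1) (Suc n) k \<le> \<alpha> k * (H' * ?c n k)"
      by (intro mult_left_mono h nonneg)
    also have "\<dots> \<le> (T' * t k) * (H' * ?c n k)"
      using False by (intro mult_right_mono t nn) auto
    finally show ?thesis by (simp add: mult_ac)
  qed
  then have "(\<Sum>k. \<alpha> k * chain_coeff \<alpha> \<beta> (\<lambda>_. 1) (Suc n) k) \<le> (\<Sum>k. (H' * T') * (t k * ?c n k))"
    by (intro suminf_le summable_mass_chain summable_mult sum)
  also have "\<dots> = (H' * T') * (\<Sum>k. t k * ?c n k)" by (rule suminf_mult[OF sum])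
  finally have "suminf \<beta> * (\<Sum>k. \<alpha> k * chain_coeff \<alpha> \<beta> (\<lambda>_. 1) (Suc n) k)
      \<le> suminf \<beta> * ((H' * T') * (\<Sum>k. t k * ?c n k))"
    using suminf_weights_pos by (intro mult_left_mono) auto
  with chain_total_Suc_le[of "Suc n"] show ?thesis by (simp only: mult.assoc)
qed

text \<open>
  All four functions of the moment problem have this form: \<open>t\<close> is \<open>\<alpha>\<close> or \<open>\<alpha>\<close> times the partial sums
  of \<open>\<beta>\<close> (from the factor \<open>P\<^sub>k(0)\<close> or \<open>Q\<^sub>k(0)\<close>), and \<open>h\<close> is \<open>1\<close> or these partial sums (from
  \<open>P\<^sub>k(z)\<close> or \<open>Q\<^sub>k(z)\<close>). Their coefficients are squeezed between multiples of chain sums, which are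
  comparable to the coefficients of \<open>G_fun p\<close> with exponential rate \<open>\<kappa> = A * B\<close>.
\<close>

lemma weighted_chain_series_growth:
  fixes c0 \<sigma> :: complex
  assumes p: "2 < p" and W: "chain_weights \<alpha> \<beta>"
    and lim: "(\<lambda>k. \<alpha> k * real (Suc k) powr u) \<longlonglongrightarrow> A"
             "(\<lambda>k. \<beta> k * real (Suc k) powr v) \<longlonglongrightarrow> B"
    and AB: "0 < A" "0 < B" "A * B = 1 / real p ^ p"
    and ex: "1 < u" "1 < v" "u + v = p"
    and t: "\<And>k. 0 \<le> t k" "\<And>k. t k \<le> T * \<alpha> k" "\<And>k. 0 < k \<Longrightarrow> \<alpha> k \<le> T' * t k"
    and h: "\<And>k. 0 \<le> h k" "\<And>k. h k \<le> H"
           "\<And>n k. chain_coeff \<alpha> \<beta> (\<lambda>_. 1) (Suc n) k \<le> H' * chain_coeff \<alpha> \<beta> h n k"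
    and f: "\<And>z. f z = c0 + z * (\<Sum>k. \<sigma> * (of_real (t k) * chain_poly \<alpha> \<beta> h k (- z)))"
    and \<sigma>: "norm \<sigma> = 1"
  shows "growth_order f = ereal (1 / p) \<and> has_growth_type f (growth_type (G_fun p) / ereal p)"
proof -
  interpret chain_weights \<alpha> \<beta> by (rule W)
  let ?w = "power_weight p"
  interpret w: chain_weights ?w ?w by (rule chain_weights_power_weight[OF p])
  let ?\<phi> = "chain_total \<alpha> \<beta>" and ?\<gamma> = "chain_total ?w ?w"
  define \<kappa> where "\<kappa> = 1 / real p ^ p"
  have p0: "0 < real p" using p by simp
  have \<kappa>: "0 < \<kappa>" using p0 by (simp add: \<kappa>_def)
  have wlim: "(\<lambda>k. ?w k * real (Suc k) powr (real p / 2)) \<longlonglongrightarrow> 1"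
    by (simp add: power_weight_def powr_add[symmetric])
  have p2: "1 < real p / 2" using p by simp
  have \<phi>\<gamma>: "\<exists>C\<ge>0. \<forall>n. ?\<phi> (Suc n) \<le> C * \<theta> ^ n * ?\<gamma> n" if "\<kappa> < \<theta>" for \<theta>
    by (rule chain_total_compare[OF W w.chain_weights_axioms lim wlim wlim AB(1,2) _ _ ex(1) p2])
       (use that AB ex in \<open>auto simp: \<kappa>_def\<close>)
  have \<gamma>\<phi>: "\<exists>C\<ge>0. \<forall>n. ?\<gamma> (Suc n) \<le> C * \<theta> ^ n * ?\<phi> n" if "1 / \<kappa> < \<theta>" for \<theta>
    by (rule chain_total_compare[OF w.chain_weights_axioms W wlim wlim lim _ _ AB(1,2) p2 ex(1)])
       (use that AB ex in \<open>auto simp: \<kappa>_def\<close>)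
  have sum\<phi>: "\<forall>r\<ge>0. summable (\<lambda>n. ?\<phi> n * r ^ n)"
  proof (intro allI impI)
    fix r :: real assume r: "0 \<le> r"
    obtain C where C: "0 \<le> C" "\<And>n. ?\<phi> (Suc n) \<le> C * (\<kappa> + 1) ^ n * ?\<gamma> n"
      using \<phi>\<gamma>[of "\<kappa> + 1"] by auto
    have "summable (\<lambda>n. ?\<phi> (Suc n) * r ^ Suc n)"
    proof (rule summable_comparison_test')
      show "summable (\<lambda>n. C * r * (?\<gamma> n * ((\<kappa> + 1) * r) ^ n))"
        using r \<kappa> by (intro summable_mult summable_chain_total_power_weight p) auto
      fix n
      have "?\<phi> (Suc n) * r ^ Suc n \<le> C * (\<kappa> + 1) ^ n * ?\<gamma> n * r ^ Suc n"
        using r by (intro mult_right_mono C) auto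
      then show "norm (?\<phi> (Suc n) * r ^ Suc n) \<le> C * r * (?\<gamma> n * ((\<kappa> + 1) * r) ^ n)"
        using r chain_total_nonneg by (simp add: power_mult_distrib mult_ac)
    qed
    then show "summable (\<lambda>n. ?\<phi> n * r ^ n)" by (subst (asm) summable_Suc_iff)
  qed
  define d where "d n = (\<Sum>k. t k * chain_coeff \<alpha> \<beta> h n k)" for n
  note series = weighted_chain_poly_sums[where h = h and t = t, OF t(1,2) h(1,2) sum\<phi>, folded d_def]
  have c0: "0 \<le> chain_coeff \<alpha> \<beta> h n k" for n k by (intro chain_coeff_nonneg nonneg h)
  have d0: "0 \<le> d n" for n
    unfolding d_def by (rule suminf_nonneg[OF series(1)]) (rule mult_nonneg_nonneg[OF t(1) c0])
  define C1 where "C1 = T * suminf \<alpha> * H"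
  have up: "d n \<le> C1 * ?\<phi> n" for n using series(3) by (simp add: C1_def)
  define C2 where "C2 = suminf \<beta> * (H' * T')"
  have lo: "?\<phi> (Suc (Suc n)) \<le> C2 * d n" if "0 < n" for n
    unfolding C2_def d_def
    by (rule chain_total_le_weighted[OF t(1,3) h(1,3) series(1) that])
  define a where "a n = (if n = 0 then c0 else \<sigma> * (- 1) ^ (n - 1) * of_real (d (n - 1)))" for n
  have norm_a: "norm (a (Suc n)) = d n" for n
    by (simp add: a_def norm_mult norm_power \<sigma> d0)
  interpret f: entire_series a f
  proof
    fix z
    have "(\<lambda>n. \<sigma> * z * (of_real (d n) * (- z) ^ n)) sums
       (\<sigma> * z * (\<Sum>k. of_real (t k) * chain_poly \<alpha> \<beta> h k (- z)))"
      by (intro sums_mult series(4))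
    also have "(\<lambda>n. \<sigma> * z * (of_real (d n) * (- z) ^ n)) = (\<lambda>n. a (Suc n) * z ^ Suc n)"
      by (rule ext) (simp add: a_def power_minus[of z] mult_ac)
    finally have "(\<lambda>n. a n * z ^ n) sums
       (\<sigma> * z * (\<Sum>k. of_real (t k) * chain_poly \<alpha> \<beta> h k (- z)) + a 0 * z ^ 0)"
      by (subst (asm) sums_Suc_iff) simp
    then show "(\<lambda>n. a n * z ^ n) sums f z"
      by (simp add: f a_def suminf_mult[OF series(2)] mult_ac add_ac)
  qed
  have \<phi>pos: "0 < ?\<phi> n" for n
  proof -
    obtain C where C: "0 \<le> C" "\<And>n. ?\<gamma> (Suc n) \<le> C * (1 / \<kappa> + 1) ^ n * ?\<phi> n"
      using \<gamma>\<phi>[of "1 / \<kappa> + 1"] by auto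
    have "0 < 1 / (fact (Suc n) :: real) ^ p" by simp
    also have "\<dots> \<le> C * (1 / \<kappa> + 1) ^ n * ?\<phi> n" using gamma_lower_bound[OF p] C(2) order_trans by blast
    finally show ?thesis using chain_total_nonneg[of n] by (cases "?\<phi> n = 0") auto
  qed
  have a2: "a 2 \<noteq> 0"
  proof
    assume "a 2 = 0"
    then have "d 1 = 0" using norm_a[of 1] by (simp add: numeral_2_eq_2)
    then show False using lo[of 1] \<phi>pos[of "Suc (Suc 1)"] by simp
  qed
  have G1: "G_coeff p 1 \<noteq> 0" by (rule G_coeff_pos[OF p zero_less_one])
  \<comment> \<open>One unit of the index shift stems from the factor \<open>z\<close> in front of the series, the other from \<open>chain_total_compare\<close>.\<close>
  have dom1: "log_dominated \<kappa> f (G_fun p)"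
  proof (rule log_dominated_coeffs[OF f.entire_series_axioms G_entire[OF p] _ a2 _ G1 _ \<kappa>])
    fix \<theta> assume \<theta>: "\<kappa> < \<theta>"
    then obtain C where C: "0 \<le> C" "\<And>n. ?\<phi> (Suc n) \<le> C * \<theta> ^ n * ?\<gamma> n" using \<phi>\<gamma> by blast
    have "norm (a (n + 2)) \<le> max C1 0 * C * \<theta> ^ n * norm (G_coeff p n)" if "1 \<le> n" for n
    proof -
      have "norm (a (n + 2)) = d (Suc n)" using norm_a[of "Suc n"] by simp
      also have "\<dots> \<le> C1 * ?\<phi> (Suc n)" by (rule up)
      also have "\<dots> \<le> max C1 0 * ?\<phi> (Suc n)" by (intro mult_right_mono chain_total_nonneg) simp
      also have "\<dots> \<le> max C1 0 * (C * \<theta> ^ n * ?\<gamma> n)" by (intro mult_left_mono C) simp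
      also have "?\<gamma> n = norm (G_coeff p n)" using that by (simp add: G_coeff_def w.chain_total_nonneg)
      finally show ?thesis by (simp add: mult_ac)
    qed
    then show "\<exists>C. \<forall>n\<ge>1. norm (a (n + 2)) \<le> C * \<theta> ^ n * norm (G_coeff p n)" by blast
  qed auto
  have dom2: "log_dominated (1 / \<kappa>) (G_fun p) f"
  proof (rule log_dominated_coeffs[OF G_entire[OF p] f.entire_series_axioms _ G1 _ a2])
    fix \<theta> assume \<theta>: "1 / \<kappa> < \<theta>"
    then obtain C where C: "0 \<le> C" "\<And>n. ?\<gamma> (Suc n) \<le> C * \<theta> ^ n * ?\<phi> n" using \<gamma>\<phi> by blast
    have \<theta>0: "0 < \<theta>" using \<theta> \<kappa> by (meson divide_pos_pos less_trans zero_less_one)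
    have "norm (G_coeff p (n + 2)) \<le> C * \<theta> * C2 * \<theta> ^ n * norm (a n)" if "2 \<le> n" for n
    proof -
      obtain k where k: "n = Suc k" "0 < k" using \<open>2 \<le> n\<close> by (cases n) auto
      have "norm (G_coeff p (n + 2)) = ?\<gamma> (Suc (Suc (Suc k)))"
        by (simp add: G_coeff_def w.chain_total_nonneg k)
      also have "\<dots> \<le> C * \<theta> ^ Suc (Suc k) * ?\<phi> (Suc (Suc k))" by (rule C)
      also have "\<dots> \<le> C * \<theta> ^ Suc (Suc k) * (C2 * d k)"
        using \<theta>0 C by (intro mult_left_mono lo k) auto
      finally show ?thesis using norm_a[of k] by (simp add: k mult_ac)
    qed
    then show "\<exists>C. \<forall>n\<ge>2. norm (G_coeff p (n + 2)) \<le> C * \<theta> ^ n * norm (a n)" by blast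
  qed (use \<kappa> in auto)
  have c: "0 < 1 / (2 * exp 1 :: real)" and \<rho>: "0 < 1 / real p" using p0 by auto
  note transfer = growth_transfer[OF dom1 dom2 \<kappa> \<rho> c G_lower_growth[OF p] G_upper_growth[OF p]]
  have "\<kappa> powr (1 / p) = 1 / p"
  proof -
    have "\<kappa> = (1 / p) powr p" using p0 by (simp add: \<kappa>_def powr_realpow power_divide)
    then show ?thesis using p0 by (simp add: powr_powr)
  qed
  then have "growth_type f = growth_type (G_fun p) / ereal p"
    using transfer(2) p0 by (cases "growth_type (G_fun p)") auto
  then show ?thesis
    unfolding has_growth_type_def
    using f.holomorphic f.not_constant[OF a2] transfer(1) \<rho> by simp
qed

section \<open>Orthogonal polynomials of a birth-death process\<close>

lemma jacobi_rec_eqI: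
  assumes b: "\<And>n. b n \<noteq> 0"
    and R: "R 0 = v" "of_real (b 0) * R 1 = (z - of_real (a 0)) * v - u"
      "\<And>n. of_real (b (Suc n)) * R (Suc (Suc n))
         = (z - of_real (a (Suc n))) * R (Suc n) - of_real (b n) * R n"
  shows "jacobi_rec a b z u v (Suc n) = R n"
proof -
  have "jacobi_rec a b z u v (Suc n) = R n \<and> jacobi_rec a b z u v (Suc (Suc n)) = R (Suc n)"
  proof (induction n)
    case 0
    then show ?case using R(1,2) b[of 0] by (simp add: field_simps)
  next
    case (Suc n)
    have "jacobi_rec a b z u v (Suc (Suc (Suc n)))
        = ((z - of_real (a (Suc n))) * R (Suc n) - of_real (b n) * R n) / of_real (b (Suc n))"
      using Suc by (subst jacobi_rec.simps(3)) (simp del: jacobi_rec.simps)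
    also have "\<dots> = R (Suc (Suc n))" using R(3)[of n] b[of "Suc n"] by (simp add: field_simps)
    finally show ?case using Suc by blast
  qed
  then show ?thesis ..
qed

text \<open>
  The potential coefficients of the birth-death process, that is, the masses of the Krein string
  attached to the moment problem; \<open>bd_gap\<close> below gives its gaps.
\<close>

definition bd_mass :: "(nat \<Rightarrow> real) \<Rightarrow> (nat \<Rightarrow> real) \<Rightarrow> nat \<Rightarrow> real" where
  "bd_mass l m n = (\<Prod>i<n. l i / m (Suc i))"

definition bd_gap :: "(nat \<Rightarrow> real) \<Rightarrow> (nat \<Rightarrow> real) \<Rightarrow> nat \<Rightarrow> real" where
  "bd_gap l m n = 1 / (l n * bd_mass l m n)"

locale birth_death =
  fixes l m :: "nat \<Rightarrow> real"
  assumes birth_pos: "0 < l n" and death_pos: "0 < m (Suc n)" and death_0: "m 0 = 0"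
begin

abbreviation "mass \<equiv> bd_mass l m"
abbreviation "gap \<equiv> bd_gap l m"
abbreviation "a \<equiv> birth_death_a l m"
abbreviation "b \<equiv> birth_death_b l m"

lemma mass_pos: "0 < mass n"
  unfolding bd_mass_def using birth_pos death_pos by (intro prod_pos) simp

lemma gap_pos: "0 < gap n"
  unfolding bd_gap_def using birth_pos mass_pos by simp

lemma mass_Suc: "m (Suc n) * mass (Suc n) = l n * mass n"
  using death_pos[of n] by (simp add: bd_mass_def)

lemma b_pos: "0 < b n"
  unfolding birth_death_b_def using birth_pos[of n] death_pos[of n] by simp

lemma b_mass: "b n * sqrt (mass (Suc n)) = l n * sqrt (mass n)"
  "b n * sqrt (mass n) = m (Suc n) * sqrt (mass (Suc n))"
proof -
  have "b n * sqrt (mass (Suc n)) = sqrt (l n * (m (Suc n) * mass (Suc n)))"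
    by (simp add: birth_death_b_def real_sqrt_mult)
  also have "\<dots> = l n * sqrt (mass n)"
    unfolding mass_Suc using birth_pos[of n] by (simp add: real_sqrt_mult)
  finally show "b n * sqrt (mass (Suc n)) = l n * sqrt (mass n)" .
  have "b n * sqrt (mass n) = sqrt (m (Suc n) * (l n * mass n))"
    by (simp add: birth_death_b_def real_sqrt_mult)
  also have "\<dots> = m (Suc n) * sqrt (mass (Suc n))"
    unfolding mass_Suc[symmetric] using death_pos[of n] by (simp add: real_sqrt_mult)
  finally show "b n * sqrt (mass n) = m (Suc n) * sqrt (mass (Suc n))" .
qed

text \<open>
  Differences of the string equation. The parameter \<open>\<eta>\<close> is the initial flux: \<open>\<eta> = 0\<close> for the
  polynomials of the first kind, \<open>\<eta> = -1\<close> for those of the second kind.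
\<close>

lemma chain_poly_three_term:
  fixes z :: complex
  assumes h: "\<And>n. h (Suc n) = h n + \<eta> * gap n"
  defines "S \<equiv> \<lambda>n. chain_poly mass gap h n (- z)"
  shows "of_real (l n) * (S (Suc n) - S n) =
           (if n = 0 then of_real \<eta> - z * S 0
            else of_real (m n) * (S n - S (n - 1)) - z * S n)"
proof -
  define T where "T n = (\<Sum>k\<le>n. of_real (mass k) * S k)" for n
  have Srec: "S N = of_real (h N) - z * (\<Sum>j<N. of_real (gap j) * T j)" for N
    unfolding S_def T_def by (subst chain_poly_rec) simp
  have flux: "of_real (l N * mass N) * (S (Suc N) - S N) = of_real \<eta> - z * T N" for N
  proof -
    have g: "of_real (l N * mass N) * of_real (gap N) = (1 :: complex)"
      using birth_pos[of N] mass_pos[of N] by (simp add: bd_gap_def)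
    have "S (Suc N) - S N = of_real (gap N) * (of_real \<eta> - z * T N)"
      by (simp add: Srec h algebra_simps)
    then show ?thesis using g by (simp only: mult.assoc[symmetric] mult_1_left)
  qed
  show ?thesis
  proof (cases n)
    case 0
    then show ?thesis using flux[of 0] by (simp add: T_def bd_mass_def)
  next
    case (Suc N)
    have "of_real (mass n) * (of_real (l n) * (S (Suc n) - S n)) = of_real \<eta> - z * T n"
      using flux[of n] by (simp add: mult_ac)
    also have "\<dots> = (of_real \<eta> - z * T N) - z * (of_real (mass n) * S n)"
      by (simp add: T_def Suc algebra_simps)
    also have "of_real \<eta> - z * T N = of_real (m n * mass n) * (S n - S N)"
      using flux[of N] by (simp add: Suc mass_Suc)
    also have "of_real (m n * mass n) * (S n - S N) - z * (of_real (mass n) * S n)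
        = of_real (mass n) * (of_real (m n) * (S n - S N) - z * S n)"
      by (simp add: algebra_simps)
    finally show ?thesis using mass_pos[of n] Suc by simp
  qed
qed

text \<open>
  Conjugation by \<open>(- 1) ^ n * sqrt (mass n)\<close> symmetrises the birth-death recurrence, by
  \<open>b_mass\<close>; the argument \<open>- z\<close> makes all coefficients of the string solution nonnegative.
\<close>

lemma jacobi_rec_eq_chain_poly:
  fixes z :: complex
  assumes h: "\<And>n. h (Suc n) = h n + \<eta> * gap n"
  shows "jacobi_rec a b z (of_real \<eta>) (of_real (h 0)) (Suc n) =
           (- 1) ^ n * of_real (sqrt (mass n)) * chain_poly mass gap h n (- z)"
proof (rule jacobi_rec_eqI)
  let ?S = "\<lambda>n. chain_poly mass gap h n (- z)"
  let ?R = "\<lambda>n. (- 1) ^ n * of_real (sqrt (mass n)) * ?S n"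
  show "b n \<noteq> 0" for n using b_pos[of n] by simp
  show R0: "?R 0 = of_real (h 0)" by (simp add: bd_mass_def chain_poly_def)
  have tt: "of_real (l n) * (?S (Suc n) - ?S n) =
           (if n = 0 then of_real \<eta> - z * ?S 0
            else of_real (m n) * (?S n - ?S (n - 1)) - z * ?S n)" for n
    by (rule chain_poly_three_term[OF h])
  have bm: "of_real (b n) * of_real (sqrt (mass (Suc n))) = (of_real (l n) * of_real (sqrt (mass n)) :: complex)"
    "of_real (b n) * of_real (sqrt (mass n)) = (of_real (m (Suc n)) * of_real (sqrt (mass (Suc n))) :: complex)" for n
    by (simp_all only: of_real_mult[symmetric] b_mass)
  show "of_real (b 0) * ?R 1 = (z - of_real (a 0)) * of_real (h 0) - of_real \<eta>"
  proof -
    have "of_real (b 0) * ?R 1 = - (of_real (b 0) * of_real (sqrt (mass (Suc 0)))) * ?S (Suc 0)" by simp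
    also have "\<dots> = - (of_real (l 0) * (?S (Suc 0) - ?S 0)) - of_real (l 0) * ?S 0"
      unfolding bm by (simp add: bd_mass_def algebra_simps)
    also have "\<dots> = (z - of_real (a 0)) * ?S 0 - of_real \<eta>"
      unfolding tt by (simp add: birth_death_a_def death_0 algebra_simps)
    finally show ?thesis by (simp add: chain_poly_def)
  qed
  fix n
  let ?q = "(- 1) ^ n * of_real (sqrt (mass (Suc n))) :: complex"
  have "of_real (b (Suc n)) * ?R (Suc (Suc n))
      = (- 1) ^ n * (of_real (b (Suc n)) * of_real (sqrt (mass (Suc (Suc n))))) * ?S (Suc (Suc n))"
    by (simp only: power_Suc mult_ac) simp
  also have "\<dots> = ?q * (of_real (l (Suc n)) * (?S (Suc (Suc n)) - ?S (Suc n)) + of_real (l (Suc n)) * ?S (Suc n))"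
    unfolding bm by (simp add: algebra_simps)
  also have "\<dots> = ?q * (of_real (l (Suc n) + m (Suc n)) * ?S (Suc n) - z * ?S (Suc n) - of_real (m (Suc n)) * ?S n)"
    unfolding tt[of "Suc n"] by (simp add: algebra_simps)
  also have "\<dots> = (z - of_real (a (Suc n))) * ?R (Suc n)
      - (- 1) ^ n * (of_real (m (Suc n)) * of_real (sqrt (mass (Suc n)))) * ?S n"
    by (simp add: birth_death_a_def algebra_simps)
  also have "\<dots> = (z - of_real (a (Suc n))) * ?R (Suc n) - of_real (b n) * ?R n"
    unfolding bm(2)[symmetric] by (simp add: mult_ac)
  finally show "of_real (b (Suc n)) * ?R (Suc (Suc n))
      = (z - of_real (a (Suc n))) * ?R (Suc n) - of_real (b n) * ?R n" .
qed

abbreviation "gaps \<equiv> \<lambda>n. \<Sum>j<n. gap j"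

lemma orth_P_eq:
  "orth_P a b n z = (- 1) ^ n * of_real (sqrt (mass n)) * chain_poly mass gap (\<lambda>_. 1) n (- z)"
  unfolding orth_P_def using jacobi_rec_eq_chain_poly[where h = "\<lambda>_. 1" and \<eta> = 0 and z = z and n = n] by simp

lemma orth_Q_eq:
  "orth_Q a b n z = (- 1) ^ n * of_real (sqrt (mass n)) * - chain_poly mass gap gaps n (- z)"
proof -
  have neg: "chain_poly mass gap (\<lambda>n. - 1 * gaps n) n (- z) = - chain_poly mass gap gaps n (- z)"
    by (simp only: chain_poly_def chain_coeff_scale) (simp add: sum_negf)
  show ?thesis
    unfolding orth_Q_def neg[symmetric]
    using jacobi_rec_eq_chain_poly[where h = "\<lambda>n. - 1 * gaps n" and \<eta> = "- 1" and z = z and n = n] by simp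
qed

end

section \<open>Asymptotics of polynomial rates\<close>

text \<open>
  Quotient of the two Gauss limits for the Gamma function.
\<close>

lemma pochhammer_ratio_asymptotics:
  fixes x y :: real
  assumes "0 < x" "0 < y"
  shows "(\<lambda>n. pochhammer x n / pochhammer y n * real (Suc n) powr (y - x)) \<longlonglongrightarrow> Gamma y / Gamma x"
proof -
  have "(\<lambda>n. Gamma_series' y n / Gamma_series' x n) \<longlonglongrightarrow> Gamma y / Gamma x"
    using Gamma_real_pos[OF assms(1)] by (intro tendsto_divide Gamma_series'_LIMSEQ) simp
  moreover have "(\<lambda>n. (real (Suc n) / real n) powr (y - x)) \<longlonglongrightarrow> 1" by real_asymp
  ultimately have "(\<lambda>n. Gamma_series' y n / Gamma_series' x n * (real (Suc n) / real n) powr (y - x))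
      \<longlonglongrightarrow> Gamma y / Gamma x * 1" by (rule tendsto_mult)
  moreover have "\<forall>\<^sub>F n in sequentially.
      Gamma_series' y n / Gamma_series' x n * (real (Suc n) / real n) powr (y - x)
      = pochhammer x n / pochhammer y n * real (Suc n) powr (y - x)"
    using eventually_gt_at_top[of 0]
  proof eventually_elim
    case (elim n)
    have "Gamma_series' y n / Gamma_series' x n
        = pochhammer x n / pochhammer y n * (exp (y * ln (real n)) / exp (x * ln (real n)))"
      by (simp add: Gamma_series'_def field_simps)
    also have "exp (y * ln (real n)) / exp (x * ln (real n)) = real n powr (y - x)"
      using elim by (simp add: powr_def exp_diff algebra_simps)
    finally show ?case using elim by (simp add: powr_divide)
  qed
  ultimately show ?thesis by (simp add: filterlim_cong)
qed

lemma bd_mass_poly_rate: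
  assumes "0 < p"
  shows "bd_mass (poly_rate p e) (poly_rate p d) n
      = (\<Prod>i=1..p. pochhammer (e i / p) n / pochhammer (1 + d i / p) n)"
proof -
  have "bd_mass (poly_rate p e) (poly_rate p d) n
      = (\<Prod>k<n. \<Prod>i=1..p. (e i / p + k) / (1 + d i / p + k))"
    unfolding bd_mass_def poly_rate_def prod_dividef[symmetric]
  proof (intro prod.cong refl)
    fix k i
    have "real p * k + e i = p * (e i / p + k)" "real p * Suc k + d i = p * (1 + d i / p + k)"
      using assms by (simp_all add: field_simps)
    then show "(real p * k + e i) / (real p * Suc k + d i) = (e i / p + k) / (1 + d i / p + k)"
      using assms by simp
  qed
  also have "\<dots> = (\<Prod>i=1..p. \<Prod>k<n. (e i / p + k) / (1 + d i / p + k))" by (rule prod.swap)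
  finally show ?thesis by (simp add: prod_dividef pochhammer_prod atLeast0LessThan)
qed

lemma poly_rate_asymptotics:
  "(\<lambda>n. poly_rate p c n / real (Suc n) ^ p) \<longlonglongrightarrow> real p ^ p"
proof -
  have "(\<lambda>n. \<Prod>i=1..p. (real p * n + c i) / real (Suc n)) \<longlonglongrightarrow> (\<Prod>i=1..p. real p)"
    by (intro tendsto_prod) real_asymp
  then show ?thesis by (simp add: poly_rate_def prod_dividef)
qed

text \<open>
  The mass is a product of \<open>p\<close> Pochhammer quotients, and their exponents
  \<open>1 + d\<^sub>i / p - e\<^sub>i / p\<close> add up to \<open>p - s\<close>.
\<close>

lemma bd_mass_asymptotics:
  assumes p: "0 < p" and e: "\<And>i. i \<in> {1..p} \<Longrightarrow> 0 < e i" and d: "\<And>i. i \<in> {1..p} \<Longrightarrow> - real p < d i"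
    and s: "s = ((\<Sum>i=1..p. e i) - (\<Sum>i=1..p. d i)) / p"
  shows "\<exists>A>0. (\<lambda>n. bd_mass (poly_rate p e) (poly_rate p d) n * real (Suc n) powr (p - s)) \<longlonglongrightarrow> A"
proof -
  define x y where "x i = e i / p" and "y i = 1 + d i / p" for i
  have xy: "0 < x i" "0 < y i" if "i \<in> {1..p}" for i
    using e[OF that] d[OF that] p by (auto simp: x_def y_def field_simps)
  have sum: "(\<Sum>i=1..p. y i - x i) = p - s"
    using p by (simp add: x_def y_def s sum_subtractf sum.distrib sum_divide_distrib[symmetric] diff_divide_distrib)
  have "(\<lambda>n. \<Prod>i=1..p. pochhammer (x i) n / pochhammer (y i) n * real (Suc n) powr (y i - x i))
      \<longlonglongrightarrow> (\<Prod>i=1..p. Gamma (y i) / Gamma (x i))"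
    by (intro tendsto_prod pochhammer_ratio_asymptotics xy)
  also have "(\<lambda>n. \<Prod>i=1..p. pochhammer (x i) n / pochhammer (y i) n * real (Suc n) powr (y i - x i))
      = (\<lambda>n. bd_mass (poly_rate p e) (poly_rate p d) n * real (Suc n) powr (p - s))"
    by (rule ext) (simp only: bd_mass_poly_rate[OF p] prod.distrib powr_sum[symmetric] sum
         of_nat_eq_0_iff nat.simps x_def[symmetric] y_def[symmetric] not_False_eq_True)
  finally show ?thesis using xy by (intro exI[of _ "\<Prod>i=1..p. Gamma (y i) / Gamma (x i)"])
    (auto intro!: prod_pos divide_pos_pos Gamma_real_pos)
qed

section \<open>The type of the moment problem\<close>

theorem theorem1p5:
  fixes p :: nat and e d :: "nat \<Rightarrow> real" and E D :: real
  assumes "p \<ge> 1"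
    and "0 < e 1" and "\<And>i. 1 \<le> i \<Longrightarrow> i < p \<Longrightarrow> e i \<le> e (i + 1)"
    and "- real p < d 1" and "\<And>i. 1 \<le> i \<Longrightarrow> i < p \<Longrightarrow> d i \<le> d (i + 1)"
    and "(\<Prod>i=1..p. d i) = 0"
    and "E = (\<Sum>i=1..p. e i)" and "D = (\<Sum>i=1..p. d i)"
    and "1 < (E - D) / real p" and "(E - D) / real p < real p - 1"
  shows "\<exists>\<tau>\<^sub>p. has_growth_type (G_fun p) \<tau>\<^sub>p \<and>
           moment_problem_has_type
             (birth_death_a (poly_rate p e) (poly_rate p d))
             (birth_death_b (poly_rate p e) (poly_rate p d))
             (\<tau>\<^sub>p / ereal (real p))"
proof -
  have p: "2 < p" using assms(9,10) by linarith
  then have p0: "0 < p" by simp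
  define s where "s = (E - D) / p"
  have increasing: "x 1 \<le> x i" if "\<And>i. 1 \<le> i \<Longrightarrow> i < p \<Longrightarrow> x i \<le> x (i + 1)" "i \<in> {1..p}"
    for x :: "nat \<Rightarrow> real" and i
  proof -
    have "1 \<le> i" using that by simp
    then show ?thesis using that(2)
    proof (induction i rule: dec_induct)
      case (step n)
      then show ?case using that(1)[of n] by auto
    qed simp
  qed
  have e: "0 < e i" if "i \<in> {1..p}" for i using increasing[of e i, OF assms(3) that] assms(2) by linarith
  have d: "- real p < d i" if "i \<in> {1..p}" for i using increasing[of d i, OF assms(5) that] assms(4) by linarith
  let ?l = "poly_rate p e" and ?m = "poly_rate p d"
  interpret birth_death ?l ?m
  proof
    show "0 < ?l n" for n
      unfolding poly_rate_def by (intro prod_pos) (simp add: e add_nonneg_pos)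
    show "0 < ?m (Suc n)" for n
      unfolding poly_rate_def
    proof (intro prod_pos)
      fix i assume "i \<in> {1..p}"
      from d[OF this] have "0 < real p * 1 + d i" by simp
      also have "\<dots> \<le> real p * real (Suc n) + d i" by (intro add_right_mono mult_left_mono) auto
      finally show "0 < real p * real (Suc n) + d i" .
    qed
    show "?m 0 = 0" using assms(6) by (simp add: poly_rate_def)
  qed
  obtain A where A: "0 < A" "(\<lambda>n. mass n * real (Suc n) powr (p - s)) \<longlonglongrightarrow> A"
    using bd_mass_asymptotics[where e = e and d = d, OF p0 e d s_def[unfolded assms(7,8)]] by auto
  have gap: "(\<lambda>n. gap n * real (Suc n) powr s) \<longlonglongrightarrow> 1 / (real p ^ p * A)"
  proof -
    have "(\<lambda>n. 1 / (?l n / real (Suc n) ^ p * (mass n * real (Suc n) powr (p - s)))) \<longlonglongrightarrow> 1 / (real p ^ p * A)"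
      using A p0 by (intro tendsto_intros poly_rate_asymptotics) auto
    moreover have "1 / (?l n / real (Suc n) ^ p * (mass n * real (Suc n) powr (p - s))) = gap n * real (Suc n) powr s" for n
      by (simp add: bd_gap_def powr_diff powr_realpow)
    ultimately show ?thesis by simp
  qed
  have us: "1 < real p - s" "1 < s" using assms(9,10) by (auto simp: s_def)
  interpret W: chain_weights mass gap
    by (rule chain_weightsI[OF mass_pos gap_pos us A(2) gap])
  have gaps: "0 \<le> gaps k" "gaps k \<le> suminf gap" for k
    by (auto intro!: sum_nonneg simp: W.nonneg W.partial_sum_le)
  have gaps0: "gap 0 \<le> gaps k" if "0 < k" for k
    using that by (intro member_le_sum) (auto simp: W.nonneg)
  let ?T = "growth_type (G_fun p) / ereal p"
  have key: "growth_order f = ereal (1 / p) \<and> has_growth_type f ?T"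
    if "t = mass \<or> t = (\<lambda>k. mass k * gaps k)" "h = (\<lambda>_. 1) \<or> h = gaps" "norm \<sigma> = 1"
       "\<And>z. f z = c0 + z * (\<Sum>k. \<sigma> * (of_real (t k) * chain_poly mass gap h k (- z)))"
    for f c0 \<sigma> t h
  proof (rule weighted_chain_series_growth[OF p W.chain_weights_axioms A(2) gap A(1) _ _ us])
    show "0 < 1 / (real p ^ p * A)" "A * (1 / (real p ^ p * A)) = 1 / real p ^ p" using A p0 by auto
    show "0 \<le> t k" "t k \<le> max 1 (suminf gap) * mass k" for k
      using that(1) gaps[of k] mass_pos[of k]
      by (auto simp: mult_le_cancel_left1 max_def mult_ac intro!: mult_right_mono)
    show "mass k \<le> max 1 (1 / gap 0) * t k" if "0 < k" for k
      using \<open>t = mass \<or> _\<close>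
    proof
      assume "t = mass"
      then show ?thesis using mass_pos[of k] by simp
    next
      assume t: "t = (\<lambda>k. mass k * gaps k)"
      have "mass k * 1 = mass k * (1 / gap 0 * gap 0)" using gap_pos[of 0] by simp
      also have "\<dots> \<le> mass k * (max 1 (1 / gap 0) * gaps k)"
        using mass_pos[of k] gap_pos[of 0] by (intro mult_left_mono mult_mono gaps0 that) auto
      finally show ?thesis by (simp add: t mult_ac)
    qed
    show "0 \<le> h k" "h k \<le> max 1 (suminf gap)" for k
      using that(2) gaps[of k] by (auto simp: max_def)
    show "chain_coeff mass gap (\<lambda>_. 1) (Suc n) k \<le> (suminf mass * max 1 (suminf gap)) * chain_coeff mass gap h n k" for n k
    proof -
      have 0: "0 \<le> chain_coeff mass gap gaps n k"
        by (intro chain_coeff_nonneg W.nonneg gaps)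
      have "chain_coeff mass gap (\<lambda>_. 1) (Suc n) k \<le> suminf mass * chain_coeff mass gap gaps n k"
        by (rule W.chain_coeff_Suc_le_gap)
      also have "\<dots> \<le> suminf mass * (max 1 (suminf gap) * chain_coeff mass gap h n k)"
      proof (intro mult_left_mono)
        show "chain_coeff mass gap gaps n k \<le> max 1 (suminf gap) * chain_coeff mass gap h n k"
          using that(2)
        proof
          assume "h = (\<lambda>_. 1)"
          then show ?thesis
            using order_trans[OF W.chain_coeff_gap_le[of n k]
                mult_right_mono[OF max.cobounded2[of "suminf gap" 1] W.chain_coeff_const_nonneg[of n k]]]
            by simp
        next
          assume "h = gaps"
          then show ?thesis using 0 mult_right_mono[OF max.cobounded1[of 1 "suminf gap"] 0] by simp
        qed
      qed (use W.suminf_weights_pos in simp)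
      finally show ?thesis by (simp add: mult_ac)
    qed
  qed (use that in auto)
  have sq: "(- 1) ^ k * of_real (sqrt (mass k)) * x * ((- 1) ^ k * of_real (sqrt (mass k)) * y)
      = of_real (mass k) * (x * y)" for k and x y :: complex
  proof -
    have "(- 1) ^ k * of_real (sqrt (mass k)) * x * ((- 1) ^ k * of_real (sqrt (mass k)) * y)
       = ((- 1) ^ k * (- 1) ^ k) * of_real (sqrt (mass k) * sqrt (mass k)) * (x * y)"
      by (simp only: of_real_mult mult_ac)
    then show ?thesis using mass_pos[of k] by (simp add: power_add[symmetric] less_imp_le)
  qed
  have at0: "chain_poly mass gap h k 0 = of_real (h k)" for h k
    by (subst chain_poly_rec) simp
  have D: "nevanlinna_D a b z
      = 0 + z * (\<Sum>k. 1 * (of_real (mass k) * chain_poly mass gap (\<lambda>_. 1) k (- z)))" for z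
    unfolding nevanlinna_D_def orth_P_eq sq by (simp add: at0)
  have C: "nevanlinna_C a b z
      = 1 + z * (\<Sum>k. - 1 * (of_real (mass k) * chain_poly mass gap gaps k (- z)))" for z
    unfolding nevanlinna_C_def orth_P_eq orth_Q_eq sq by (simp add: at0)
  have B: "nevanlinna_B a b z
      = - 1 + z * (\<Sum>k. - 1 * (of_real (mass k * gaps k) * chain_poly mass gap (\<lambda>_. 1) k (- z)))" for z
    unfolding nevanlinna_B_def orth_P_eq orth_Q_eq sq by (simp add: at0 mult_ac)
  have A': "nevanlinna_A a b z
      = 0 + z * (\<Sum>k. 1 * (of_real (mass k * gaps k) * chain_poly mass gap gaps k (- z)))" for z
    unfolding nevanlinna_A_def orth_Q_eq sq by (simp add: at0 mult_ac)
  have "moment_problem_has_type a b ?T"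
    unfolding moment_problem_has_type_def
  proof (intro exI[of _ "ereal (1 / p)"] ballI)
    fix f assume "f \<in> {nevanlinna_A a b, nevanlinna_B a b, nevanlinna_C a b, nevanlinna_D a b}"
    then consider "f = nevanlinna_A a b" | "f = nevanlinna_B a b" | "f = nevanlinna_C a b" | "f = nevanlinna_D a b"
      by blast
    then show "growth_order f = ereal (1 / p) \<and> has_growth_type f ?T"
    proof cases
      case 1 show ?thesis unfolding 1 by (rule key[OF _ _ _ A']) auto
    next
      case 2 show ?thesis unfolding 2 by (rule key[OF _ _ _ B]) auto
    next
      case 3 show ?thesis unfolding 3 by (rule key[OF _ _ _ C]) auto
    next
      case 4 show ?thesis unfolding 4 by (rule key[OF _ _ _ D]) auto
    qed
  qed
  then show ?thesis using G_has_growth_type[OF p] by blast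
qed

end
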